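(* Fix $T>0$, $L>0$. Let $u_0\in L^1(\mathbb{R})\cap BV(\mathbb{R})$ and $z_0\in L^1(\mathbb{R};\tilde{\mathcal S}_L)\cap BV(\mathbb{R};\tilde{\mathcal S}_L)$, with $\xi_{z_0(x)}$ a union of finitely many segments for every $x$, and $(u_0(x),z_0(x;\rho))\in\mathcal{L}_\rho$ for a.e. $x\in\mathbb{R}$, $\rho\in\mathcal{T}$. Let $(u,w)$, with $w=\int_{\mathcal{T}}z\,d\rho$, be the solution of the Cauchy problem $$u_t+w_t+u_x=0,\quad w=[\mathcal{H}(u,z_0)],\quad u(x,0)=u_0(x)\qquad\text{in }\mathbb{R}\times[0,T)$$ constructed via the wave-front tracking method (as described in the context). Then $(u,w)$ is an entropy solution, i.e. $$\int_{\mathbb{R}}\int_0^T\Big[|u-k|+\int_{\mathcal{T}}|z-\hat z|\,d\rho\Big]\phi_t+|u-k|\phi_x\,dt\,dx\ge0$$ for every nonnegative $\phi\in C^\infty(\mathbb{R}\times[0,+\infty))$ with compact support in $\mathbb{R}\times(0,+\infty)$, every $k\in\mathbb{R}$ and every $\hat z\in\tilde{\mathcal S}$, $\hat z:\mathcal{T}\to\{-1,+1\}$, such that $(k,\hat z(\rho))\in\mathcal{L}_\rho$.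
   Context: **Relay.** For $\rho=(\rho_1,\rho_2)$ with $\rho_1<\rho_2$ let $\mathcal{L}_\rho=\{(u,z):u>\rho_1,\ z=+1\}\cup\{(u,z):u<\rho_2,\ z=-1\}$. For continuous $u:[0,T]\to\mathbb{R}$ and $\zeta\in\{-1,1\}$ with $(u(0),\zeta)\in\mathcal{L}_\rho$, $[h^\rho(u,\zeta)]:[0,T]\to\{-1,1\}$ is the output of the delayed relay: it starts from $\zeta$; while $+1$ it stays $+1$ until $u$ reaches $\rho_1$, when it switches to $-1$; while $-1$ it stays $-1$ until $u$ reaches $\rho_2$, when it switches to $+1$. For piecewise constant $u$ with finitely many jumps, $h^\rho(u,\zeta)$ is the limit of $h^\rho(u_\varepsilon,\zeta)$ with $u_\varepsilon\to u$ continuous and filling the jumps of $u$ monotonically. **Preisach plane.** $\mathcal{P}=\{\rho_1<\rho_2\}\subset\mathbb{R}^2$; $a>0$ is fixed and $\mathcal{T}$ is the triangle with vertices $(-a,-a),(a,a),(-a,a)$; $d\rho$ is Lebesgue measure. Virgin state: $z_v(\rho)=-1$ if $\rho_2>-\rho_1$, $+1$ if $\rho_2<-\rho_1$. $\tilde{\mathcal S}$ is the set of all $z:\mathcal{P}\to\{-1,1\}$ of the form $z(\rho)=[h^\rho(u,z_v(\rho))](T)$, $u\in C^0([0,T])$; $\tilde{\mathcal S}_L$ is the subset generated by $L$-Lipschitz $u$. Metric: $d(z_1,z_2)=\int_{\mathcal{T}}|z_1-z_2|\,d\rho$. Graph: $\xi_z=\partial\{z=-1\}\cap\partial\{z=+1\}$.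 Preisach operator: $[\mathcal{H}(u,z_0)](t)=\int_{\mathcal{T}}[h^\rho(u,z_0(\rho))](t)\,d\rho$, applied for each fixed $x$. $z\in L^1(\mathbb{R};\tilde{\mathcal S}_L)$ means $\int_{\mathbb{R}}d(z(x),z_v)\,dx<\infty$; $Var$ and $BV(\mathbb{R};\tilde{\mathcal S}_L)$ are the total variation (minimum over a.e.-representatives) and bounded variation with respect to $d$. **Grid.** $A_n=\{k2^{-n}:k\in\mathbb{Z}\}$, $Q_n=(A_n\times A_n)\cap\mathcal{T}$, and $\tilde{\mathcal S}_L^{(n)}$ is the set of $z\in\tilde{\mathcal S}_L$ whose graph $\xi_z$ consists of finitely many segments with vertices in $Q_n$. **Approximate Riemann solver.** Given states $(u_l,z_l),(u_r,z_r)$ to the left and right of a point $(x_1,t_1)$, with $u_l,u_r\in A_n$: let $u_r=v_0,v_1,\dots,v_m=u_l$ be the monotone sequence in $A_n$ with consecutive differences of modulus $2^{-n}$, and let $z^j$ be the configuration obtained from $z_r$ by the relays when the input moves monotonically from $u_r$ to $v_j$ (so $z^0=z_r$). The solution consists, from right to left, of the states $(v_0,z^0),(v_1,z^1),\dots,(v_m,z^m)$, where the front between $(v_j,z^j)$ and $(v_{j+1},z^{j+1})$ emanates from $(x_1,t_1)$ with the Rankine–Hugoniot speed $\frac{v_{j+1}-v_j}{v_{j+1}-v_j+\int_{\mathcal{T}}(z^{j+1}-z^j)\,d\rho}$, followed (if $z_l\ne z^m$) by a stationary discontinuity at $x=x_1$ separating $(u_l,z^m)$ (right) from $(u_l,z_l)$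 (left). **Wave-front tracking construction.** Choose right-continuous piecewise constant $u_0^{(n)}:\mathbb{R}\to A_n$, $z_0^{(n)}:\mathbb{R}\to\tilde{\mathcal S}_L^{(n)}$ with finitely many discontinuities, mutually compatible ($(u_0^{(n)}(x),z_0^{(n)}(x;\rho))\in\mathcal{L}_\rho$ for a.e. $x,\rho$), with $Var(u_0^{(n)})\le Var(u_0)$, $Var(z_0^{(n)})\le Var(z_0)$, and converging to $u_0,z_0$ uniformly and in $L^1(\mathbb{R})$, $L^1(\mathbb{R};\tilde{\mathcal S}_L)$. Let $u_n,z_n$ be obtained by applying the approximate Riemann solver at each initial discontinuity, propagating the fronts, and applying it again at every point where fronts (including stationary ones) meet. Put $w_n=\int_{\mathcal{T}}z_n\,d\rho$. The constructed solution is the limit along a subsequence: $u_n\to u$ in $L^1(\mathbb{R}\times(0,T))$, $\int_0^T\!\int_{\mathbb{R}}d(z_n,z)\,dx\,dt\to0$, $w=\int_{\mathcal{T}}z\,d\rho$. *)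

theory Defs
  imports "HOL-Analysis.Analysis"
begin

section \<open>Delayed relays and the Preisach plane\<close>

type_synonym config = "real \<times> real \<Rightarrow> real"

definition relay_domain :: "real \<times> real \<Rightarrow> (real \<times> real) set" where
  "relay_domain \<rho> = {(u, z). u > fst \<rho> \<and> z = 1} \<union> {(u, z). u < snd \<rho> \<and> z = -1}"

text \<open>
  For continuous \<open>u\<close> the set \<open>X\<close> is compact, so \<open>Sup X\<close> is the last time in \<open>[0, t]\<close>
  at which \<open>u\<close> attains one of the two thresholds; the threshold attained then determines the
  output. The definition is meant for \<open>(u 0, \<zeta>) \<in> relay_domain \<rho>\<close> and \<open>fst \<rho> < snd \<rho>\<close>.
\<close>

definition relay :: "real \<times> real \<Rightarrow> (real \<Rightarrow> real) \<Rightarrow> real \<Rightarrow> real \<Rightarrow> real" where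
  "relay \<rho> u \<zeta> t =
     (let X = {s \<in> {0..t}. u s = fst \<rho> \<or> u s = snd \<rho>}
      in if X = {} then \<zeta> else if u (Sup X) = fst \<rho> then -1 else 1)"

definition half_plane :: "(real \<times> real) set" where
  "half_plane = {\<rho>. fst \<rho> < snd \<rho>}"

definition preisach_triangle :: "real \<Rightarrow> (real \<times> real) set" where
  "preisach_triangle a = convex hull {(-a, -a), (a, a), (-a, a)}"

text \<open>
  Maps from the half plane to \<open>{-1, 1}\<close> are represented by extensional functions. The diagonal,
  which belongs to \<open>preisach_triangle a\<close> but not to the half plane, is a null set. On the null set
  \<open>snd \<rho> = - fst \<rho>\<close> the virgin state is given the value \<open>-1\<close> by convention.
\<close>

definition virgin :: config where
  "virgin = (\<lambda>\<rho>\<in>half_plane. if snd \<rho> < - fst \<rho> then 1 else -1)"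

definition configs :: "real \<Rightarrow> config set" where
  "configs a = {z \<in> half_plane \<rightarrow>\<^sub>E {-1, 1}. z \<in> borel_measurable (lebesgue_on (preisach_triangle a))}"

definition states :: "real \<Rightarrow> config set" where
  "states T = {(\<lambda>\<rho>\<in>half_plane. relay \<rho> u (virgin \<rho>) T) | u.
     continuous_on {0..T} u \<and> (\<forall>\<rho>\<in>half_plane. (u 0, virgin \<rho>) \<in> relay_domain \<rho>)}"

definition lip_states :: "real \<Rightarrow> real \<Rightarrow> config set" where
  "lip_states T L = {(\<lambda>\<rho>\<in>half_plane. relay \<rho> u (virgin \<rho>) T) | u.
     L-lipschitz_on {0..T} u \<and> (\<forall>\<rho>\<in>half_plane. (u 0, virgin \<rho>) \<in> relay_domain \<rho>)}"

definition cdist :: "real \<Rightarrow> config \<Rightarrow> config \<Rightarrow> real" where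
  "cdist a z1 z2 = (LINT \<rho>:preisach_triangle a|lebesgue. \<bar>z1 \<rho> - z2 \<rho>\<bar>)"

definition state_graph :: "config \<Rightarrow> (real \<times> real) set" where
  "state_graph z = frontier {\<rho> \<in> half_plane. z \<rho> = -1} \<inter> frontier {\<rho> \<in> half_plane. z \<rho> = 1}"

text \<open>
  The graph is considered inside the triangle: outside it always contains an unbounded part of the
  antidiagonal. Segments may leave the triangle and are then clipped; otherwise the graph of
  the virgin state, which ends at the corner \<open>(-a, a)\<close>, would be excluded from the grid
  states below whenever \<open>a\<close> is not a grid point. Graphs composed of segments with vertices in
  \<open>V \<inter> preisach_triangle a\<close> are included, since the triangle is convex.
\<close>

definition polygonal_graph :: "real \<Rightarrow> (real \<times> real) set \<Rightarrow> config \<Rightarrow> bool" where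
  "polygonal_graph a V z \<longleftrightarrow>
     (\<exists>F \<subseteq> V \<times> V. finite F \<and>
        state_graph z \<inter> preisach_triangle a = preisach_triangle a \<inter> (\<Union>(p, q)\<in>F. closed_segment p q))"

definition grid :: "nat \<Rightarrow> real set" where
  "grid n = {real_of_int k / 2 ^ n | k. True}"

definition grid_states :: "real \<Rightarrow> real \<Rightarrow> real \<Rightarrow> nat \<Rightarrow> config set" where
  "grid_states a T L n = {z \<in> lip_states T L. polygonal_graph a (grid n \<times> grid n) z}"

section \<open>Integrability and variation of maps into a (pseudo)metric space\<close>

text \<open>
  Measurability with respect to the separable pseudometric \<open>cdist a\<close>.
\<close>

definition config_measurable :: "real \<Rightarrow> 'a measure \<Rightarrow> ('a \<Rightarrow> config) \<Rightarrow> bool" where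
  "config_measurable a M f \<longleftrightarrow> (\<forall>\<zeta>\<in>configs a. (\<lambda>x. cdist a (f x) \<zeta>) \<in> borel_measurable M)"

definition L1_lip :: "real \<Rightarrow> real \<Rightarrow> real \<Rightarrow> (real \<Rightarrow> config) set" where
  "L1_lip a T L = {z. (\<forall>x. z x \<in> lip_states T L) \<and> config_measurable a lebesgue z \<and>
     integrable lebesgue (\<lambda>x. cdist a (z x) virgin)}"

definition variation :: "('b \<Rightarrow> 'b \<Rightarrow> real) \<Rightarrow> (real \<Rightarrow> 'b) \<Rightarrow> ennreal" where
  "variation d f = (SUP xs \<in> {xs. sorted xs}.
     \<Sum>i < length xs - 1. ennreal (d (f (xs ! i)) (f (xs ! Suc i))))"

text \<open>
  Infimum over the \<open>A\<close>-valued representatives, equality being understood modulo \<open>d = 0\<close>.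
\<close>

definition Var :: "('b \<Rightarrow> 'b \<Rightarrow> real) \<Rightarrow> 'b set \<Rightarrow> (real \<Rightarrow> 'b) \<Rightarrow> ennreal" where
  "Var d A f = (INF g \<in> {g. range g \<subseteq> A \<and> (AE x in lebesgue. d (g x) (f x) = 0)}. variation d g)"

definition compatible :: "real \<Rightarrow> (real \<Rightarrow> real) \<Rightarrow> (real \<Rightarrow> config) \<Rightarrow> bool" where
  "compatible a u z \<longleftrightarrow>
     (AE x in lebesgue. AE \<rho> in lebesgue_on (preisach_triangle a). (u x, z x \<rho>) \<in> relay_domain \<rho>)"

section \<open>The approximate Riemann solver\<close>

type_synonym state = "real \<times> config"

definition shift :: "real \<Rightarrow> real \<Rightarrow> config \<Rightarrow> config" where
  "shift u v z = (\<lambda>\<rho>\<in>half_plane. relay \<rho> (\<lambda>s. (1 - s) * u + s * v) (z \<rho>) 1)"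

definition intermediate :: "nat \<Rightarrow> real \<Rightarrow> real \<Rightarrow> nat \<Rightarrow> real" where
  "intermediate n ul ur j = ur + sgn (ul - ur) * real j / 2 ^ n"

definition intermediate_config :: "nat \<Rightarrow> real \<Rightarrow> state \<Rightarrow> nat \<Rightarrow> config" where
  "intermediate_config n ul r j =
     (if j = 0 then snd r else shift (fst r) (intermediate n ul (fst r) j) (snd r))"

definition rh_speed :: "real \<Rightarrow> state \<Rightarrow> state \<Rightarrow> real" where
  "rh_speed a s s' = (fst s' - fst s) /
     (fst s' - fst s + (LINT \<rho>:preisach_triangle a|lebesgue. snd s' \<rho> - snd s \<rho>))"

text \<open>
  The fan is a list of pairs (front speed, state immediately to the right of that front), from left
  to right; so the fronts occur in the order of decreasing index \<open>j\<close>, possibly preceded by a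
  stationary one. For \<open>ul\<close>, \<open>ur\<close> in \<open>grid n\<close> the number \<open>m\<close> of moving fronts is exactly
  \<open>\<bar>ul - ur\<bar> * 2 ^ n\<close>.
\<close>

definition riemann_fan :: "real \<Rightarrow> nat \<Rightarrow> state \<Rightarrow> state \<Rightarrow> (real \<times> state) list" where
  "riemann_fan a n l r =
     (let ul = fst l; zl = snd l; ur = fst r;
          m = nat \<lfloor>\<bar>ul - ur\<bar> * 2 ^ n\<rfloor>;
          S = (\<lambda>j. (intermediate n ul ur j, intermediate_config n ul r j))
      in (if zl \<noteq> snd (S m) then [(0, (ul, snd (S m)))] else []) @
         map (\<lambda>j. (rh_speed a (S j) (S (Suc j)), S j)) (rev [0..<m]))"

section \<open>Wave-front tracking\<close>

text \<open>Right-continuous, piecewise constant, with finitely many discontinuities.\<close>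

definition step_function :: "(real \<Rightarrow> 'b) \<Rightarrow> bool" where
  "step_function f \<longleftrightarrow> (\<exists>D. finite D \<and> (\<forall>x y. x \<le> y \<and> D \<inter> {x<..y} = {} \<longrightarrow> f x = f y))"

definition left_value :: "(real \<Rightarrow> 'b) \<Rightarrow> real \<Rightarrow> 'b" where
  "left_value f y = (THE s. \<forall>\<^sub>F x in at_left y. f x = s)"

definition value_at_minus_infinity :: "(real \<Rightarrow> 'b) \<Rightarrow> 'b" where
  "value_at_minus_infinity f = (THE s. \<forall>\<^sub>F x in at_bot. f x = s)"

definition jumps :: "(real \<Rightarrow> 'b) \<Rightarrow> real set" where
  "jumps f = {y. left_value f y \<noteq> f y}"

text \<open>
  All fronts emanating from the discontinuities of the profile \<open>f\<close>, from left to right, each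
  given by its starting point, its speed and the state immediately to its right.
\<close>

definition fronts :: "real \<Rightarrow> nat \<Rightarrow> (real \<Rightarrow> state) \<Rightarrow> (real \<times> real \<times> state) list" where
  "fronts a n f = concat (map
     (\<lambda>y. map (\<lambda>(\<sigma>, s). (y, \<sigma>, s)) (riemann_fan a n (left_value f y) (f y)))
     (sorted_list_of_set (jumps f)))"

definition front_position :: "real \<Rightarrow> real \<times> real \<times> state \<Rightarrow> real" where
  "front_position h p = fst p + fst (snd p) * h"

definition propagate :: "real \<Rightarrow> nat \<Rightarrow> (real \<Rightarrow> state) \<Rightarrow> real \<Rightarrow> real \<Rightarrow> state" where
  "propagate a n f h x =
     (let ps = filter (\<lambda>p. front_position h p \<le> x) (fronts a n f)
      in if ps = [] then value_at_minus_infinity f else snd (snd (last ps)))"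

text \<open>
  \<open>U t x\<close> is the state at time \<open>t\<close> and position \<open>x\<close>. In each of the time intervals between
  consecutive \<open>\<tau> i\<close> the fronts keep their order, so that fronts of different speeds cannot meet
  except at the \<open>\<tau> i\<close>, when the solver is applied at all discontinuities. Applying it at a front
  not involved in an interaction reproduces that front, so it is harmless that this happens at every
  discontinuity present at time \<open>\<tau> i\<close> and that the \<open>\<tau> i\<close> need not all be interaction times.
\<close>

definition front_tracking ::
    "real \<Rightarrow> real \<Rightarrow> nat \<Rightarrow> (real \<Rightarrow> state) \<Rightarrow> (real \<Rightarrow> real \<Rightarrow> state) \<Rightarrow> bool" where
  "front_tracking a T n f U \<longleftrightarrow> U 0 = f \<and>
     (\<exists>\<tau> N. \<tau> 0 = 0 \<and> \<tau> N = T \<and>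
        (\<forall>i<N. \<tau> i < \<tau> (Suc i) \<and>
           (\<forall>t\<in>{\<tau> i..\<tau> (Suc i)}.
              sorted (map (front_position (t - \<tau> i)) (fronts a n (U (\<tau> i)))) \<and>
              U t = propagate a n (U (\<tau> i)) (t - \<tau> i))))"

definition approximate_data ::
    "real \<Rightarrow> real \<Rightarrow> real \<Rightarrow> (real \<Rightarrow> real) \<Rightarrow> (real \<Rightarrow> config) \<Rightarrow>
     (nat \<Rightarrow> real \<Rightarrow> real) \<Rightarrow> (nat \<Rightarrow> real \<Rightarrow> config) \<Rightarrow> bool" where
  "approximate_data a T L u0 z0 v \<zeta> \<longleftrightarrow>
     (\<forall>n. step_function (v n) \<and> range (v n) \<subseteq> grid n \<and>
          step_function (\<zeta> n) \<and> range (\<zeta> n) \<subseteq> grid_states a T L n \<and>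
          compatible a (v n) (\<zeta> n) \<and>
          Var dist UNIV (v n) \<le> Var dist UNIV u0 \<and>
          Var (cdist a) (lip_states T L) (\<zeta> n) \<le> Var (cdist a) (lip_states T L) z0) \<and>
     (\<forall>\<epsilon>>0. \<forall>\<^sub>F n in sequentially. AE x in lebesgue. \<bar>v n x - u0 x\<bar> \<le> \<epsilon>) \<and>
     (\<forall>\<epsilon>>0. \<forall>\<^sub>F n in sequentially. AE x in lebesgue. cdist a (\<zeta> n x) (z0 x) \<le> \<epsilon>) \<and>
     (\<lambda>n. \<integral>\<^sup>+x. ennreal \<bar>v n x - u0 x\<bar> \<partial>lebesgue) \<longlonglongrightarrow> 0 \<and>
     (\<lambda>n. \<integral>\<^sup>+x. ennreal (cdist a (\<zeta> n x) (z0 x)) \<partial>lebesgue) \<longlonglongrightarrow> 0"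

definition strip :: "real \<Rightarrow> (real \<times> real) set" where
  "strip T = UNIV \<times> {0<..<T}"

text \<open>
  Points of the strip are pairs \<open>(x, t)\<close>. The values \<open>z x t\<close> are only required to be
  measurable configurations, because \<open>states T\<close> is not closed with respect to \<open>cdist a\<close>. That
  the limit solves the Cauchy problem for \<open>u_t + w_t + u_x = 0\<close> with \<open>w\<close> the Preisach output
  of \<open>u\<close> is a consequence of the construction and is therefore not imposed as a further condition.
\<close>

definition constructed_solution ::
    "real \<Rightarrow> real \<Rightarrow> real \<Rightarrow> (real \<Rightarrow> real) \<Rightarrow> (real \<Rightarrow> config) \<Rightarrow>
     (real \<Rightarrow> real \<Rightarrow> real) \<Rightarrow> (real \<Rightarrow> real \<Rightarrow> config) \<Rightarrow> (real \<Rightarrow> real \<Rightarrow> real) \<Rightarrow> bool" where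
  "constructed_solution a T L u0 z0 u z w \<longleftrightarrow>
     set_integrable lebesgue (strip T) (\<lambda>(x, t). u x t) \<and>
     (AE (x, t) in lebesgue_on (strip T). z x t \<in> configs a) \<and>
     config_measurable a (lebesgue_on (strip T)) (\<lambda>(x, t). z x t) \<and>
     (AE (x, t) in lebesgue_on (strip T). w x t = (LINT \<rho>:preisach_triangle a|lebesgue. z x t \<rho>)) \<and>
     (\<exists>v \<zeta> U r. approximate_data a T L u0 z0 v \<zeta> \<and>
        (\<forall>n. front_tracking a T n (\<lambda>x. (v n x, \<zeta> n x)) (U n)) \<and>
        strict_mono (r :: nat \<Rightarrow> nat) \<and>
        (\<lambda>i. \<integral>\<^sup>+(x, t)\<in>strip T. ennreal \<bar>fst (U (r i) t x) - u x t\<bar> \<partial>lebesgue) \<longlonglongrightarrow> 0 \<and>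
        (\<lambda>i. \<integral>\<^sup>+(x, t)\<in>strip T. ennreal (cdist a (snd (U (r i) t x)) (z x t)) \<partial>lebesgue) \<longlonglongrightarrow> 0)"

section \<open>Entropy solutions\<close>

text \<open>
  \<open>D i j\<close> is the partial derivative of order \<open>i\<close> in the first and \<open>j\<close> in the second variable.
\<close>

definition smooth_on :: "(real \<times> real) set \<Rightarrow> (real \<times> real \<Rightarrow> real) \<Rightarrow> bool" where
  "smooth_on S \<phi> \<longleftrightarrow> (\<exists>D. D 0 0 = \<phi> \<and>
     (\<forall>i j. \<forall>p\<in>S. (D i j has_derivative
        (\<lambda>h. fst h * D (Suc i) j p + snd h * D i (Suc j) p)) (at p within S)))"

definition test_function :: "(real \<times> real \<Rightarrow> real) \<Rightarrow> bool" where
  "test_function \<phi> \<longleftrightarrow>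
     smooth_on (UNIV \<times> {0..}) \<phi> \<and>
     compact (closure {p \<in> UNIV \<times> {0..}. \<phi> p \<noteq> 0}) \<and>
     closure {p \<in> UNIV \<times> {0..}. \<phi> p \<noteq> 0} \<subseteq> UNIV \<times> {0<..} \<and>
     (\<forall>p \<in> UNIV \<times> {0..}. \<phi> p \<ge> 0)"

definition entropy_integrand ::
    "real \<Rightarrow> (real \<Rightarrow> real \<Rightarrow> real) \<Rightarrow> (real \<Rightarrow> real \<Rightarrow> config) \<Rightarrow> real \<Rightarrow> config \<Rightarrow>
     (real \<times> real \<Rightarrow> real) \<Rightarrow> real \<times> real \<Rightarrow> real" where
  "entropy_integrand a u z k zh \<phi> = (\<lambda>(x, t).
     (\<bar>u x t - k\<bar> + (LINT \<rho>:preisach_triangle a|lebesgue. \<bar>z x t \<rho> - zh \<rho>\<bar>)) * deriv (\<lambda>s. \<phi> (x, s)) t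
     + \<bar>u x t - k\<bar> * deriv (\<lambda>y. \<phi> (y, t)) x)"

text \<open>
  Integrability is stated explicitly because the integral of a non-integrable function is \<open>0\<close>.
\<close>

definition entropy_solution ::
    "real \<Rightarrow> real \<Rightarrow> (real \<Rightarrow> real \<Rightarrow> real) \<Rightarrow> (real \<Rightarrow> real \<Rightarrow> config) \<Rightarrow> bool" where
  "entropy_solution a T u z \<longleftrightarrow>
     (\<forall>\<phi> k zh. test_function \<phi> \<and> zh \<in> states T \<and>
        (\<forall>\<rho> \<in> preisach_triangle a \<inter> half_plane. (k, zh \<rho>) \<in> relay_domain \<rho>) \<longrightarrow>
        set_integrable lebesgue (strip T) (entropy_integrand a u z k zh \<phi>) \<and>
        (LINT p:strip T|lebesgue. entropy_integrand a u z k zh \<phi> p) \<ge> 0)"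

end

theory Submission
  imports Defs
begin

text \<open>
  For \<open>k\<close> in the grid and \<open>zh\<close> compatible with \<open>k\<close>, put \<open>q (u, z) = \<bar>u - k\<bar>\<close> and
  \<open>\<eta> (u, z) = \<bar>u - k\<bar> + cdist z zh\<close>. The fronts of the solver join neighbouring grid values, so \<open>k\<close>
  never lies strictly between them, and across such a front from \<open>l\<close> (left) to \<open>r\<close> (right) with
  Rankine--Hugoniot speed \<open>\<sigma>\<close> one has \<open>\<sigma> (\<eta> l - \<eta> r) \<le> q l - q r\<close>: either \<open>q l - q r\<close> is the full
  jump of \<open>u\<close> and the triangle inequality suffices, or compatibility forces \<open>zh\<close> to agree with the
  left state on all relays that switch, and equality holds. Shearing along the fronts and summing the
  jumps, this gives the entropy inequality for the approximate solutions, where the boundary term at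
  time \<open>T\<close> has the favourable sign. For general \<open>k\<close> one replaces \<open>k\<close> by the largest grid point \<open>k\<^sub>n\<close>
  below it and moves \<open>zh\<close> along; the error tends to \<open>0\<close>, and \<open>L\<^sup>1\<close> convergence does the rest.
\<close>

section \<open>Integration along fronts\<close>

text \<open>In the pair \<open>\<eta>\<close>, \<open>q\<close> the density sees the memory and the
  flux does not, because only \<open>u\<close> is transported. Restricting \<open>k\<close> to the
  grid is what shapes the argument: the solver replaces continuous waves by jumps of height
  \<open>1 / 2 ^ n\<close>, and since the amount of switched relays may grow faster than linearly
  along such a jump, the entropy inequality can fail for \<open>k\<close> strictly inside it. The
  surplus \<open>q l - q r - \<sigma> * (\<eta> l - \<eta> r)\<close> of a front enters the
  integrated inequality multiplied by the integral of the test function along that front, which is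
  nonnegative; so the jump inequality is exactly what is required. Writing a profile as a linear
  combination of indicators of half lines allows the fronts to be treated one at a time.
  Compatibility is needed for the tracked states as well as for \<open>zh\<close>: it turns the
  relay output after a monotone input into a single threshold formula with a fixed background
  configuration, so that all relays switched inside one fan switch in the same direction.\<close>

lemma borel_measurable_fst_snd [measurable]:
  "fst \<in> borel_measurable (borel :: (real \<times> real) measure)"
  "snd \<in> borel_measurable (borel :: (real \<times> real) measure)"
  by (auto intro!: borel_measurable_continuous_onI continuous_intros)

text \<open>A C1 function on the whole plane, \<open>\<phi>x\<close> and \<open>\<phi>t\<close>
  being its partial derivatives. A test function is given only for nonnegative times; it enters
  through its extension by zero. Outside the box of half-width \<open>R\<close> everything vanishes,
  which makes all integrals below finite.\<close>

locale c1_test =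
  fixes \<phi> \<phi>x \<phi>t :: "real \<times> real \<Rightarrow> real" and R :: real
  assumes has_derivative_\<phi>:
      "\<And>p. (\<phi> has_derivative (\<lambda>h. fst h * \<phi>x p + snd h * \<phi>t p)) (at p)"
    and continuous_\<phi>x: "continuous_on UNIV \<phi>x"
    and continuous_\<phi>t: "continuous_on UNIV \<phi>t"
    and nonneg: "\<And>p. 0 \<le> \<phi> p"
    and support: "\<And>x t. R < \<bar>x\<bar> \<or> R < \<bar>t\<bar> \<Longrightarrow> \<phi> (x, t) = 0"
begin

lemma continuous_\<phi>: "continuous_on UNIV \<phi>"
  by (meson has_derivative_\<phi> has_derivative_continuous continuous_at_imp_continuous_on)

lemma measurable_test [measurable]:
  "\<phi> \<in> borel_measurable borel" "\<phi>x \<in> borel_measurable borel" "\<phi>t \<in> borel_measurable borel"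
  using continuous_\<phi> continuous_\<phi>x continuous_\<phi>t
  by (auto intro: borel_measurable_continuous_onI)

lemmas measurable_test_prod [measurable] = measurable_test[unfolded borel_prod[symmetric]]

text \<open>The exterior of the box is open, so \<open>\<phi>\<close> has derivative zero there, and
  uniqueness of the derivative applied to the two unit vectors gives both partial
  derivatives.\<close>

lemma support_deriv:
  assumes "R < \<bar>x\<bar> \<or> R < \<bar>t\<bar>"
  shows "\<phi>x (x, t) = 0" "\<phi>t (x, t) = 0"
proof -
  let ?S = "{p. R < \<bar>fst p\<bar>} \<union> {p. R < \<bar>snd p :: real\<bar>}"
  have "open ?S"
    by (intro open_Un open_Collect_less continuous_intros)
  moreover have "(x, t) \<in> ?S" using assms by auto
  moreover have "\<phi> p = 0" if "p \<in> ?S" for p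
    using support[of "fst p" "snd p"] that by auto
  moreover have "((\<lambda>_. 0) has_derivative (\<lambda>_. 0)) (at (x, t))"
    by simp
  ultimately have "(\<phi> has_derivative (\<lambda>_. 0)) (at (x, t))"
    using has_derivative_transform_within_open[of "\<lambda>_. 0" "\<lambda>_. 0" "(x,t)" UNIV ?S \<phi>] by simp
  then have "(\<lambda>h. fst h * \<phi>x (x, t) + snd h * \<phi>t (x, t)) = (\<lambda>_. 0)"
    using has_derivative_\<phi> has_derivative_unique by blast
  from fun_cong[OF this, of "(1, 0)"] fun_cong[OF this, of "(0, 1)"]
  show "\<phi>x (x, t) = 0" "\<phi>t (x, t) = 0" by auto
qed

lemma integrable_test:
  assumes "b \<in> borel_measurable borel" "\<And>p. \<bar>b p\<bar> \<le> B"
  shows "integrable lborel (\<lambda>p. b p * \<phi>x p)" "integrable lborel (\<lambda>p. b p * \<phi>t p)"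
proof -
  have *: "integrable lborel (\<lambda>p. b p * \<psi> p)"
    if \<psi>: "continuous_on UNIV \<psi>" "\<And>x t. R < \<bar>x\<bar> \<or> R < \<bar>t\<bar> \<Longrightarrow> \<psi> (x, t) = 0" for \<psi>
  proof -
    let ?S = "cbox (-R, -R) (R, R)"
    have [measurable]: "\<psi> \<in> borel_measurable borel" "b \<in> borel_measurable borel"
      using \<psi> assms by (auto intro: borel_measurable_continuous_onI)
    have "integrable lborel (\<lambda>p. indicator ?S p *\<^sub>R \<psi> p)"
      by (rule borel_integrable_compact) (auto intro: continuous_on_subset[OF \<psi>(1)])
    then have "integrable lborel (\<lambda>p. B * (indicator ?S p *\<^sub>R \<psi> p))"
      by (rule integrable_mult_right)
    then show ?thesis
    proof (rule Bochner_Integration.integrable_bound)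
      show "AE p in lborel. norm (b p * \<psi> p) \<le> norm (B * (indicator ?S p *\<^sub>R \<psi> p))"
      proof (rule AE_I2)
        fix p :: "real \<times> real"
        obtain x t where p: "p = (x, t)" by fastforce
        show "norm (b p * \<psi> p) \<le> norm (B * (indicator ?S p *\<^sub>R \<psi> p))"
        proof (cases "R < \<bar>x\<bar> \<or> R < \<bar>t\<bar>")
          case True
          then show ?thesis using \<psi>(2) p by simp
        next
          case False
          then have "p \<in> ?S" by (auto simp: p cbox_Pair_eq)
          moreover have "\<bar>b p\<bar> \<le> \<bar>B\<bar>" using assms(2)[of p] by linarith
          ultimately show ?thesis by (simp add: abs_mult mult_right_mono)
        qed
      qed
    qed simp
  qed
  show "integrable lborel (\<lambda>p. b p * \<phi>x p)" "integrable lborel (\<lambda>p. b p * \<phi>t p)"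
    using * continuous_\<phi>x continuous_\<phi>t support_deriv by auto
qed

lemma integrable_slice:
  assumes "b \<in> borel_measurable borel" "\<And>x. \<bar>b x\<bar> \<le> B"
  shows "integrable lborel (\<lambda>x. b x * \<phi> (x, t))"
proof -
  have [measurable]: "b \<in> borel_measurable borel" by fact
  have c: "continuous_on A (\<lambda>x. \<phi> (x, t))" for A
    by (rule continuous_on_compose2[OF continuous_\<phi>]) (auto intro!: continuous_intros)
  have [measurable]: "(\<lambda>x. \<phi> (x, t)) \<in> borel_measurable borel"
    using c by (auto intro: borel_measurable_continuous_onI)
  have "integrable lborel (\<lambda>x. indicator {-R..R} x *\<^sub>R \<phi> (x, t))"
    by (rule borel_integrable_compact) (use c in auto)
  then have "integrable lborel (\<lambda>x. B * (indicator {-R..R} x *\<^sub>R \<phi> (x, t)))"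
    by (rule integrable_mult_right)
  then show ?thesis
  proof (rule Bochner_Integration.integrable_bound)
    show "AE x in lborel. norm (b x * \<phi> (x, t)) \<le> norm (B * (indicator {-R..R} x *\<^sub>R \<phi> (x, t)))"
    proof (rule AE_I2)
      fix x
      have "\<bar>b x\<bar> \<le> \<bar>B\<bar>" using assms(2)[of x] by linarith
      then show "norm (b x * \<phi> (x, t)) \<le> norm (B * (indicator {-R..R} x *\<^sub>R \<phi> (x, t)))"
        using support[of x t] by (cases "R < \<bar>x\<bar>") (auto simp: abs_mult mult_right_mono indicator_def)
    qed
  qed simp
qed

text \<open>The chain rule along a front that starts in \<open>x\<close> at time
  \<open>\<tau>\<close> with speed \<open>\<sigma>\<close>.\<close>

lemma has_real_derivative_line:
  "((\<lambda>s. \<phi> (x + \<sigma> * (s - \<tau>), s)) has_real_derivative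
     \<phi>t (x + \<sigma> * (t - \<tau>), t) + \<sigma> * \<phi>x (x + \<sigma> * (t - \<tau>), t)) (at t)"
proof -
  have "((\<lambda>s. (x + \<sigma> * (s - \<tau>), s)) has_derivative (\<lambda>h. (\<sigma> * h, h))) (at t)"
    by (auto intro!: derivative_eq_intros)
  from has_derivative_compose[OF this has_derivative_\<phi>]
  show ?thesis
    unfolding has_field_derivative_def
    by (rule has_derivative_eq_rhs) (auto simp: algebra_simps)
qed

lemma has_real_derivative_fst:
  "((\<lambda>y. \<phi> (y, t)) has_real_derivative \<phi>x (x, t)) (at x)"
proof -
  have "((\<lambda>y. (y, t)) has_derivative (\<lambda>h. (h, 0))) (at x)"
    by (auto intro!: derivative_eq_intros)
  from has_derivative_compose[OF this has_derivative_\<phi>]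
  show ?thesis
    unfolding has_field_derivative_def
    by (rule has_derivative_eq_rhs) (auto simp: algebra_simps)
qed

lemma continuous_shift:
  assumes "continuous_on UNIV \<psi>" "continuous_on A f" "continuous_on A g"
  shows "continuous_on A (\<lambda>s. \<psi> (f s, g s) :: real)"
  by (rule continuous_on_compose2[OF assms(1)]) (auto intro!: continuous_intros assms)

lemma integral_fst_below: "(LBINT x. indicator {..<c} x * \<phi>x (x, t)) = \<phi> (c, t)"
proof -
  \<comment> \<open>A left endpoint outside the box, where \<open>\<phi>\<close> vanishes, and not
    beyond \<open>c\<close> even if \<open>c\<close> itself lies to the left of the box.\<close>
  define m where "m = min c (- R - 1)"
  have eq: "(LBINT x. indicator {..<c} x * \<phi>x (x, t)) = (LBINT x. indicator {m..c} x *\<^sub>R \<phi>x (x, t))"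
  proof (rule integral_cong_AE)
    show "AE x in lborel. indicator {..<c} x * \<phi>x (x, t) = indicator {m..c} x *\<^sub>R \<phi>x (x, t)"
      using AE_lborel_singleton[of c]
    proof eventually_elim
      case (elim x)
      have "x < m \<Longrightarrow> \<phi>x (x, t) = 0"
        using support_deriv(1)[of x t] unfolding m_def by linarith
      then show ?case using elim by (auto simp: indicator_def)
    qed
  qed measurable
  have "m \<le> c" by (simp add: m_def)
  have "(LBINT x. indicator {m..c} x *\<^sub>R \<phi>x (x, t)) = \<phi> (c, t) - \<phi> (m, t)"
  proof (rule integral_FTC_Icc[OF \<open>m \<le> c\<close>])
    show "((\<lambda>x. \<phi> (x, t)) has_vector_derivative \<phi>x (x, t)) (at x within {m..c})" for x
      using has_real_derivative_fst[of t x]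
      by (simp add: has_real_derivative_iff_has_vector_derivative has_vector_derivative_at_within)
    show "continuous_on {m..c} (\<lambda>x. \<phi>x (x, t))"
      by (intro continuous_shift[OF continuous_\<phi>x] continuous_intros)
  qed
  moreover have "\<phi> (m, t) = 0"
    by (rule support) (auto simp: m_def)
  ultimately show ?thesis using eq by simp
qed

lemma integral_line:
  assumes "\<tau> \<le> \<tau>'"
  shows "(LBINT s. indicator {\<tau>..<\<tau>'} s *
           (\<phi>t (x + \<sigma> * (s - \<tau>), s) + \<sigma> * \<phi>x (x + \<sigma> * (s - \<tau>), s))) =
         \<phi> (x + \<sigma> * (\<tau>' - \<tau>), \<tau>') - \<phi> (x, \<tau>)"
proof -
  let ?f = "\<lambda>s. \<phi>t (x + \<sigma> * (s - \<tau>), s) + \<sigma> * \<phi>x (x + \<sigma> * (s - \<tau>), s)"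
  have c: "continuous_on {\<tau>..\<tau>'} ?f"
    by (intro continuous_intros continuous_shift[OF continuous_\<phi>x] continuous_shift[OF continuous_\<phi>t])
  have "(LBINT s. indicator {\<tau>..<\<tau>'} s * ?f s) = (LBINT s. indicator {\<tau>..\<tau>'} s *\<^sub>R ?f s)"
  proof (rule integral_cong_AE)
    show "AE s in lborel. indicator {\<tau>..<\<tau>'} s * ?f s = indicator {\<tau>..\<tau>'} s *\<^sub>R ?f s"
      using AE_lborel_singleton[of \<tau>'] by eventually_elim (auto simp: indicator_def)
  qed measurable
  also have "\<dots> = \<phi> (x + \<sigma> * (\<tau>' - \<tau>), \<tau>') - \<phi> (x + \<sigma> * (\<tau> - \<tau>), \<tau>)"
  proof (rule integral_FTC_Icc[OF assms _ c])
    show "((\<lambda>s. \<phi> (x + \<sigma> * (s - \<tau>), s)) has_vector_derivative ?f s) (at s within {\<tau>..\<tau>'})" for s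
      using has_real_derivative_line[of x \<sigma> \<tau> s]
      by (simp add: has_real_derivative_iff_has_vector_derivative has_vector_derivative_at_within)
  qed
  finally show ?thesis by simp
qed

text \<open>Shearing along the front turns the two-dimensional integral into one along characteristics.\<close>

lemma integral_sheared:
  fixes b :: "real \<Rightarrow> real"
  assumes "\<tau> \<le> \<tau>'" and [measurable]: "b \<in> borel_measurable borel" and B: "\<And>x. \<bar>b x\<bar> \<le> B"
  shows "(LBINT p. indicator {\<tau>..<\<tau>'} (snd p) * b (fst p - \<sigma> * (snd p - \<tau>)) *
            (\<phi>t p + \<sigma> * \<phi>x p)) =
         (LBINT x. b (x - \<sigma> * (\<tau>' - \<tau>)) * \<phi> (x, \<tau>')) - (LBINT x. b x * \<phi> (x, \<tau>))"
    (is "?lhs = _")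
proof -
  let ?c = "\<lambda>p. indicator {\<tau>..<\<tau>'} (snd p) * b (fst p - \<sigma> * (snd p - \<tau>)) :: real"
  let ?g = "\<lambda>p. ?c p * (\<phi>t p + \<sigma> * \<phi>x p)"
  have le: "\<bar>?c p\<bar> \<le> B" for p
    using B[of "fst p - \<sigma> * (snd p - \<tau>)"] B[of 0] by (auto simp: indicator_def)
  have "integrable lborel (\<lambda>p. ?c p * \<phi>t p)" "integrable lborel (\<lambda>p. ?c p * \<phi>x p)"
    by (rule integrable_test[OF _ le]; measurable)+
  then have "integrable lborel (\<lambda>p. ?c p * \<phi>t p + \<sigma> * (?c p * \<phi>x p))"
    by (intro Bochner_Integration.integrable_add integrable_mult_right)
  then have int: "integrable lborel ?g"
    by (simp add: algebra_simps)
  \<comment> \<open>The integrand in the coordinates that move with the front: here \<open>b\<close>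
    no longer depends on \<open>t\<close>, so that the time integral can be evaluated by
    \<open>integral_line\<close>.\<close>
  define h where "h = (\<lambda>x t. indicator {\<tau>..<\<tau>'} t * b x *
    (\<phi>t (x + \<sigma> * (t - \<tau>), t) + \<sigma> * \<phi>x (x + \<sigma> * (t - \<tau>), t)))"
  have [measurable]: "case_prod h \<in> borel_measurable (lborel \<Otimes>\<^sub>M lborel)"
    unfolding h_def by measurable
  have h: "h x t = ?g (x + \<sigma> * (t - \<tau>), t)" for x t
    by (simp add: h_def)
  have "?lhs = (LBINT t. LBINT x. ?g (x, t))"
    using lborel_pair.integral_snd[of "\<lambda>x t. ?g (x, t)"] int
    by (simp add: lborel_prod split_def)
  also have "\<dots> = (LBINT t. LBINT x. h x t)"
  proof (rule Bochner_Integration.integral_cong[OF refl])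
    fix t
    show "(LBINT x. ?g (x, t)) = (LBINT x. h x t)"
      unfolding h
      by (subst lborel_integral_real_affine[of 1 _ "\<sigma> * (t - \<tau>)"]) (auto simp: add.commute)
  qed
  \<comment> \<open>Exchanging the integrals requires integrability of \<open>h\<close>. It is
    transferred from \<open>?g\<close> by Tonelli, since for each fixed \<open>t\<close> the two
    differ only by a translation in \<open>x\<close>.\<close>
  also have "\<dots> = (LBINT x. LBINT t. h x t)"
  proof (rule lborel_pair.Fubini_integral)
    have [measurable]: "?g \<in> borel_measurable borel"
      using borel_measurable_integrable[OF int] by simp
    have "(\<integral>\<^sup>+p. ennreal (norm (case_prod h p)) \<partial>(lborel \<Otimes>\<^sub>M lborel)) =
        (\<integral>\<^sup>+t. \<integral>\<^sup>+x. ennreal (norm (h x t)) \<partial>lborel \<partial>lborel)"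
      by (subst lborel_pair.nn_integral_snd[symmetric]) auto
    also have "\<dots> = (\<integral>\<^sup>+t. \<integral>\<^sup>+x. ennreal (norm (?g (x, t))) \<partial>lborel \<partial>lborel)"
    proof (rule nn_integral_cong)
      fix t :: real
      show "(\<integral>\<^sup>+x. ennreal (norm (h x t)) \<partial>lborel) = (\<integral>\<^sup>+x. ennreal (norm (?g (x, t))) \<partial>lborel)"
        unfolding h
        by (subst (2) nn_integral_real_affine[of _ 1 "\<sigma> * (t - \<tau>)"])
           (auto simp: add.commute)
    qed
    also have "\<dots> = (\<integral>\<^sup>+p. ennreal (norm (?g p)) \<partial>lborel)"
      using lborel_pair.nn_integral_snd[of "\<lambda>p. ennreal (norm (?g p))"]
      by (simp add: lborel_prod)
    also have "\<dots> < \<infinity>"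
      using int by (simp add: integrable_iff_bounded)
    finally show "integrable (lborel \<Otimes>\<^sub>M lborel) (case_prod h)"
      by (simp add: integrable_iff_bounded)
  qed
  also have "\<dots> = (LBINT x. b x * (\<phi> (x + \<sigma> * (\<tau>' - \<tau>), \<tau>') - \<phi> (x, \<tau>)))"
  proof (rule Bochner_Integration.integral_cong[OF refl])
    fix x
    have "(LBINT t. h x t) = (LBINT s. b x * (indicator {\<tau>..<\<tau>'} s *
           (\<phi>t (x + \<sigma> * (s - \<tau>), s) + \<sigma> * \<phi>x (x + \<sigma> * (s - \<tau>), s))))"
      by (simp add: h_def mult_ac)
    then show "(LBINT t. h x t) = b x * (\<phi> (x + \<sigma> * (\<tau>' - \<tau>), \<tau>') - \<phi> (x, \<tau>))"
      using integral_line[OF assms(1), of x \<sigma>] by simp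
  qed
  also have "\<dots> = (LBINT x. b x * \<phi> (x + \<sigma> * (\<tau>' - \<tau>), \<tau>')) - (LBINT x. b x * \<phi> (x, \<tau>))"
  proof -
    have i: "integrable lborel (\<lambda>x. b (x - \<sigma> * (\<tau>' - \<tau>)) * \<phi> (x, \<tau>'))"
      by (rule integrable_slice) (auto intro: B)
    have "integrable lborel (\<lambda>x. b x * \<phi> (x + \<sigma> * (\<tau>' - \<tau>), \<tau>'))"
      using lborel_integrable_real_affine[OF i, of 1 "\<sigma> * (\<tau>' - \<tau>)"] by (simp add: add.commute)
    moreover have "integrable lborel (\<lambda>x. b x * \<phi> (x, \<tau>))"
      by (rule integrable_slice[OF _ B]) auto
    ultimately show ?thesis by (simp add: right_diff_distrib)
  qed
  also have "(LBINT x. b x * \<phi> (x + \<sigma> * (\<tau>' - \<tau>), \<tau>')) = (LBINT x. b (x - \<sigma> * (\<tau>' - \<tau>)) * \<phi> (x, \<tau>'))"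
    by (subst (2) lborel_integral_real_affine[of 1 _ "\<sigma> * (\<tau>' - \<tau>)"]) (auto simp: add.commute)
  finally show ?thesis .
qed

end

section \<open>Profiles as sums of jumps across fronts\<close>

text \<open>
  The last summand is the state to the right of all fronts. The sum represents the profile only as
  long as the fronts are in order.
\<close>

primrec step_sum ::
    "(state \<Rightarrow> real) \<Rightarrow> state \<Rightarrow> (real \<times> real \<times> state) list \<Rightarrow> real \<Rightarrow> real \<Rightarrow> real" where
  "step_sum g s [] h x = g s"
| "step_sum g s (p # ps) h x =
     (g s - g (snd (snd p))) * indicator {..<front_position h p} x + step_sum g (snd (snd p)) ps h x"

text \<open>A front stores only the state to its right; its left state is the right state of its
  predecessor and is therefore passed along the list.\<close>

primrec chain ::
    "(state \<Rightarrow> real \<Rightarrow> state \<Rightarrow> bool) \<Rightarrow> state \<Rightarrow> (real \<times> real \<times> state) list \<Rightarrow> bool" where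
  "chain Q s [] \<longleftrightarrow> True"
| "chain Q s (p # ps) \<longleftrightarrow> Q s (fst (snd p)) (snd (snd p)) \<and> chain Q (snd (snd p)) ps"

text \<open>Fronts at or to the left of \<open>x\<close> contribute nothing and only replace the
  current state. At the first front beyond \<open>x\<close> the order puts all later ones beyond
  \<open>x\<close> too, and the remaining jumps telescope to the current state.\<close>

lemma step_sum_eq:
  assumes "sorted (map (front_position h) ps)"
  shows "step_sum g s ps h x =
    g (let qs = filter (\<lambda>p. front_position h p \<le> x) ps in if qs = [] then s else snd (snd (last qs)))"
  using assms
proof (induction ps arbitrary: s)
  case Nil
  then show ?case by simp
next
  case (Cons p ps)
  show ?case
  proof (cases "front_position h p \<le> x")
    case True
    then show ?thesis using Cons by (auto simp: Let_def)
  next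
    case False
    then have "filter (\<lambda>p. front_position h p \<le> x) ps = []"
      using Cons.prems by (auto simp: filter_empty_conv)
    then show ?thesis using Cons False by (auto simp: Let_def)
  qed
qed

lemma step_sum_bounded: "\<exists>B. \<forall>h x. \<bar>step_sum g s ps h x\<bar> \<le> B"
proof (induction ps arbitrary: s)
  case Nil
  then show ?case by auto
next
  case (Cons p ps)
  obtain B where B: "\<And>h x. \<bar>step_sum g (snd (snd p)) ps h x\<bar> \<le> B"
    using Cons by blast
  have "\<bar>step_sum g s (p # ps) h x\<bar> \<le> \<bar>g s - g (snd (snd p))\<bar> + B" for h x
    using B[of h x] by (auto simp: indicator_def)
  then show ?case by blast
qed

lemma step_sum_measurable [measurable]:
  "(\<lambda>p. step_sum g s ps (snd p - \<tau>) (fst p)) \<in> borel_measurable (borel :: (real \<times> real) measure)"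
proof (induction ps arbitrary: s)
  case (Cons p ps)
  have [measurable]: "(\<lambda>q. step_sum g (snd (snd p)) ps (snd q - \<tau>) (fst q))
      \<in> borel_measurable (borel :: (real \<times> real) measure)"
    by (rule Cons)
  have [measurable]: "{q. fst q < front_position (snd q - \<tau>) p} \<in> sets (borel :: (real \<times> real) measure)"
    unfolding front_position_def
    by (intro borel_open open_Collect_less continuous_intros)
  have "indicat_real {..<front_position (snd q - \<tau>) p} (fst q) =
      indicat_real {q. fst q < front_position (snd q - \<tau>) p} q" for q
    by (simp add: indicator_def)
  then show ?case by simp
qed simp

lemma step_sum_measurable_slice [measurable]: "step_sum g s ps h \<in> borel_measurable borel"
proof (induction ps arbitrary: s)
  case (Cons p ps)
  have [measurable]: "step_sum g (snd (snd p)) ps h \<in> borel_measurable borel"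
    by (rule Cons)
  show ?case unfolding step_sum.simps by measurable
next
  case Nil
  have "step_sum g s [] h = (\<lambda>_. g s)" for s by auto
  then show ?case by simp
qed

context c1_test
begin

text \<open>\<open>S\<close> is the indicator of the part of the slab to the left of the front.
  Integrating \<open>\<phi>x\<close> over it in \<open>x\<close> first leaves the integral of
  \<open>\<phi>\<close> along the front, hence the sign. In sheared coordinates the region is a
  product, so \<open>integral_sheared\<close> with a half line as weight gives the last
  identity.\<close>

lemma integral_front:
  fixes y \<sigma> :: real
  assumes "\<tau> \<le> \<tau>'"
  defines "S \<equiv> \<lambda>p. indicator {\<tau>..<\<tau>'} (snd p) * indicator {..<y + \<sigma> * (snd p - \<tau>)} (fst p) :: real"
  defines "H \<equiv> \<lambda>t. LBINT x. indicator {..<y + \<sigma> * (t - \<tau>)} x * \<phi> (x, t)"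
  shows "integrable lborel (\<lambda>p. S p * \<phi>x p)" "integrable lborel (\<lambda>p. S p * \<phi>t p)"
    and "0 \<le> (LBINT p. S p * \<phi>x p)"
    and "(LBINT p. S p * \<phi>t p) = H \<tau>' - H \<tau> - \<sigma> * (LBINT p. S p * \<phi>x p)"
proof -
  have [measurable]: "{q. fst q < y + \<sigma> * (snd q - \<tau>)} \<in> sets (borel :: (real \<times> real) measure)"
    by (intro borel_open open_Collect_less continuous_intros)
  have S: "S = (\<lambda>p. indicator {\<tau>..<\<tau>'} (snd p) * indicator {q. fst q < y + \<sigma> * (snd q - \<tau>)} p)"
    by (auto simp: S_def indicator_def)
  have [measurable]: "S \<in> borel_measurable borel"
    unfolding S by measurable
  have le: "\<bar>S p\<bar> \<le> 1" for p
    by (simp add: S indicator_def)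
  show int: "integrable lborel (\<lambda>p. S p * \<phi>x p)" "integrable lborel (\<lambda>p. S p * \<phi>t p)"
    by (rule integrable_test[OF _ le]; measurable)+
  have "(LBINT p. S p * \<phi>x p) = (LBINT t. LBINT x. S (x, t) * \<phi>x (x, t))"
    using lborel_pair.integral_snd[of "\<lambda>x t. S (x, t) * \<phi>x (x, t)"] int
    by (simp add: lborel_prod split_def)
  also have "\<dots> = (LBINT t. indicator {\<tau>..<\<tau>'} t * \<phi> (y + \<sigma> * (t - \<tau>), t))"
    using integral_fst_below by (simp add: S_def mult.assoc)
  also have "\<dots> \<ge> 0"
    by (intro integral_nonneg_AE AE_I2 mult_nonneg_nonneg nonneg) auto
  finally show "0 \<le> (LBINT p. S p * \<phi>x p)" .
  have eq: "indicator {..<y} (x - \<sigma> * (t - \<tau>)) = (indicator {..<y + \<sigma> * (t - \<tau>)} x :: real)" for x t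
    by (auto simp: indicator_def)
  have "(LBINT p. S p * (\<phi>t p + \<sigma> * \<phi>x p)) = H \<tau>' - H \<tau>"
    using integral_sheared[OF assms(1), of "indicator {..<y}" 1 \<sigma>]
    by (simp add: eq S_def H_def)
  then show "(LBINT p. S p * \<phi>t p) = H \<tau>' - H \<tau> - \<sigma> * (LBINT p. S p * \<phi>x p)"
    using int by (simp add: algebra_simps)
qed

text \<open>Handles the constant that remains to the right of all fronts. With constant weight the
  value in \<open>integral_sheared\<close> does not depend on \<open>\<sigma>\<close>; comparing
  \<open>\<sigma> = 0\<close> with \<open>\<sigma> = 1\<close> isolates the integral of
  \<open>\<phi>x\<close>.\<close>

lemma integral_slab:
  assumes "\<tau> \<le> \<tau>'"
  defines "S \<equiv> \<lambda>p. indicator {\<tau>..<\<tau>'} (snd p) :: real"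
  shows "integrable lborel (\<lambda>p. S p * \<phi>x p)" "integrable lborel (\<lambda>p. S p * \<phi>t p)"
    and "(LBINT p. S p * \<phi>x p) = 0"
    and "(LBINT p. S p * \<phi>t p) = (LBINT x. \<phi> (x, \<tau>')) - (LBINT x. \<phi> (x, \<tau>))"
proof -
  have [measurable]: "S \<in> borel_measurable borel"
    unfolding S_def by measurable
  have le: "\<bar>S p\<bar> \<le> 1" for p
    by (simp add: S_def indicator_def)
  show int: "integrable lborel (\<lambda>p. S p * \<phi>x p)" "integrable lborel (\<lambda>p. S p * \<phi>t p)"
    by (rule integrable_test[OF _ le]; measurable)+
  have *: "(LBINT p. S p * (\<phi>t p + \<sigma> * \<phi>x p)) = (LBINT x. \<phi> (x, \<tau>')) - (LBINT x. \<phi> (x, \<tau>))" for \<sigma>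
    using integral_sheared[OF assms(1), of "\<lambda>_. 1" 1 \<sigma>] by (simp add: S_def)
  from *[of 0] show t: "(LBINT p. S p * \<phi>t p) = (LBINT x. \<phi> (x, \<tau>')) - (LBINT x. \<phi> (x, \<tau>))"
    by simp
  with *[of 1] show "(LBINT p. S p * \<phi>x p) = 0"
    using int by (simp add: algebra_simps)
qed

text \<open>\<open>W\<close> and \<open>E\<close> are both linear in the jumps, so the claim follows
  by adding one front at a time. The fronts may be in any order here; \<open>sorted\<close> is only
  required to recognise the sums as profiles.\<close>

lemma entropy_slab:
  assumes "\<tau> \<le> \<tau>'"
    and "chain (\<lambda>l \<sigma> r. \<sigma> * (\<eta> l - \<eta> r) \<le> q l - q r) s ps"
  defines "W \<equiv> \<lambda>s ps p. indicator {\<tau>..<\<tau>'} (snd p) *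
      (step_sum \<eta> s ps (snd p - \<tau>) (fst p) * \<phi>t p + step_sum q s ps (snd p - \<tau>) (fst p) * \<phi>x p)"
  defines "E \<equiv> \<lambda>s ps t. LBINT x. step_sum \<eta> s ps (t - \<tau>) x * \<phi> (x, t)"
  shows "integrable lborel (W s ps)" "E s ps \<tau>' - E s ps \<tau> \<le> integral\<^sup>L lborel (W s ps)"
proof -
  have "integrable lborel (W s ps) \<and> E s ps \<tau>' - E s ps \<tau> \<le> integral\<^sup>L lborel (W s ps)"
    using assms(2)
  proof (induction ps arbitrary: s)
    case Nil
    have W: "W s [] = (\<lambda>p. \<eta> s * (indicator {\<tau>..<\<tau>'} (snd p) * \<phi>t p) + q s * (indicator {\<tau>..<\<tau>'} (snd p) * \<phi>x p))"
      by (auto simp: W_def algebra_simps)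
    show ?case
      using integral_slab[OF assms(1)] by (simp add: W E_def right_diff_distrib)
  next
    case (Cons p ps)
    obtain y \<sigma> r where p: "p = (y, \<sigma>, r)"
      using prod_cases3 by blast
    let ?S = "\<lambda>p. indicator {\<tau>..<\<tau>'} (snd p) * indicator {..<y + \<sigma> * (snd p - \<tau>)} (fst p) :: real"
    let ?H = "\<lambda>t. LBINT x. indicator {..<y + \<sigma> * (t - \<tau>)} x * \<phi> (x, t)"
    let ?I = "LBINT p. ?S p * \<phi>x p"
    note front = integral_front[OF assms(1), of y \<sigma>]
    have IH: "integrable lborel (W r ps)" "E r ps \<tau>' - E r ps \<tau> \<le> integral\<^sup>L lborel (W r ps)"
      using Cons by (auto simp: p)
    have W: "W s (p # ps) = (\<lambda>p. (\<eta> s - \<eta> r) * (?S p * \<phi>t p) + (q s - q r) * (?S p * \<phi>x p) + W r ps p)"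
      by (auto simp: W_def p front_position_def algebra_simps)
    have E: "E s (p # ps) t = (\<eta> s - \<eta> r) * ?H t + E r ps t" for t
    proof -
      have "integrable lborel (\<lambda>x. indicator {..<y + \<sigma> * (t - \<tau>)} x * \<phi> (x, t))"
        by (rule integrable_slice[where B = 1]) auto
      moreover obtain B where "\<And>h x. \<bar>step_sum \<eta> r ps h x\<bar> \<le> B"
        using step_sum_bounded by blast
      then have "integrable lborel (\<lambda>x. step_sum \<eta> r ps (t - \<tau>) x * \<phi> (x, t))"
        by (intro integrable_slice) auto
      ultimately show ?thesis
        by (simp add: E_def p front_position_def distrib_right mult.assoc)
    qed
    \<comment> \<open>The surplus in the jump inequality times \<open>?I\<close>, the integral of
      \<open>\<phi>\<close> along the front: this is the amount by which the front contributes in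
      the favourable direction.\<close>
    have "0 \<le> (q s - q r - \<sigma> * (\<eta> s - \<eta> r)) * ?I"
      using Cons.prems front(3) by (intro mult_nonneg_nonneg) (auto simp: p)
    then have "(\<eta> s - \<eta> r) * (?H \<tau>' - ?H \<tau>) \<le>
        (\<eta> s - \<eta> r) * (LBINT p. ?S p * \<phi>t p) + (q s - q r) * ?I"
      unfolding front(4) by (simp add: algebra_simps)
    moreover have "integral\<^sup>L lborel (W s (p # ps)) =
        (\<eta> s - \<eta> r) * (LBINT p. ?S p * \<phi>t p) + (q s - q r) * ?I + integral\<^sup>L lborel (W r ps)"
      unfolding W using front(1,2) IH(1) by simp
    moreover have "integrable lborel (W s (p # ps))"
      unfolding W using front(1,2) IH(1) by simp
    ultimately show ?case
      using IH(2) by (simp add: E right_diff_distrib)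
  qed
  then show "integrable lborel (W s ps)" "E s ps \<tau>' - E s ps \<tau> \<le> integral\<^sup>L lborel (W s ps)"
    by auto
qed

end

section \<open>Configurations and relays\<close>

lemma compact_preisach_triangle: "compact (preisach_triangle a)"
  unfolding preisach_triangle_def by (intro finite_imp_compact_convex_hull) auto

lemma sets_preisach_triangle [simp]: "preisach_triangle a \<in> sets lebesgue"
  using compact_preisach_triangle lmeasurable_compact by blast

lemma finite_measure_triangle: "finite_measure (lebesgue_on (preisach_triangle a))"
  using compact_preisach_triangle lmeasurable_compact
  by (intro finite_measure_lebesgue_on) auto

lemma preisach_triangle_le:
  assumes "\<rho> \<in> preisach_triangle a" "0 < a"
  shows "fst \<rho> \<le> snd \<rho>"
proof -
  have "convex {\<rho> :: real \<times> real. fst \<rho> \<le> snd \<rho>}"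
    by (auto simp: convex_def intro!: add_mono mult_left_mono)
  then have "preisach_triangle a \<subseteq> {\<rho>. fst \<rho> \<le> snd \<rho>}"
    unfolding preisach_triangle_def using assms(2) by (intro hull_minimal) auto
  then show ?thesis using assms(1) by auto
qed

lemma borel_measurable_lebesgue_on_borel:
  "f \<in> borel_measurable borel \<Longrightarrow> f \<in> borel_measurable (lebesgue_on (A :: 'a::euclidean_space set))"
  by (intro measurable_restrict_space1 measurable_completion) simp

lemma sets_half_plane [measurable]: "half_plane \<in> sets borel"
  unfolding half_plane_def by (intro borel_open open_Collect_less continuous_intros)

lemma AE_lebesgue_on_negligible:
  assumes "negligible N" "S \<in> sets lebesgue"
  shows "AE x in lebesgue_on S. x \<notin> N"
proof -
  have "N \<in> null_sets lebesgue"
    using assms by (simp add: negligible_iff_null_sets)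
  then have "AE x in lebesgue. x \<notin> N"
    by (rule AE_not_in)
  then show ?thesis
    using assms(2) by (subst AE_restrict_space_iff) (auto elim: eventually_mono)
qed

text \<open>Relays with a threshold exactly at a given input value lie on a line; discarding them
  removes the distinction between strict and weak inequalities for the thresholds.\<close>

lemma AE_fst_neq: "AE \<rho> in lebesgue_on (preisach_triangle a). fst \<rho> \<noteq> c"
  and AE_snd_neq: "AE \<rho> in lebesgue_on (preisach_triangle a). snd \<rho> \<noteq> c"
proof -
  have "negligible {\<rho> :: real \<times> real. (1, 0) \<bullet> \<rho> = c}" "negligible {\<rho> :: real \<times> real. (0, 1) \<bullet> \<rho> = c}"
    by (auto intro!: negligible_hyperplane simp: zero_prod_def)
  from this[THEN AE_lebesgue_on_negligible, of "preisach_triangle a"]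
  show "AE \<rho> in lebesgue_on (preisach_triangle a). fst \<rho> \<noteq> c"
    and "AE \<rho> in lebesgue_on (preisach_triangle a). snd \<rho> \<noteq> c"
    by (auto elim!: eventually_mono simp: inner_prod_def)
qed

text \<open>The triangle lies on one side of the diagonal, and the diagonal, where configurations
  take no meaningful values, is a null set.\<close>

lemma AE_half_plane:
  assumes "0 < a"
  shows "AE \<rho> in lebesgue_on (preisach_triangle a). \<rho> \<in> half_plane"
proof -
  have "negligible {\<rho> :: real \<times> real. (1, -1) \<bullet> \<rho> = 0}"
    by (auto intro!: negligible_hyperplane simp: zero_prod_def)
  from AE_lebesgue_on_negligible[OF this, of "preisach_triangle a"]
  have "AE \<rho> in lebesgue_on (preisach_triangle a). fst \<rho> \<noteq> snd \<rho>"
    by (auto elim!: eventually_mono simp: inner_prod_def)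
  then show ?thesis
  proof (rule AE_mp, intro AE_I2 impI)
    fix \<rho> assume "\<rho> \<in> space (lebesgue_on (preisach_triangle a))" "fst \<rho> \<noteq> snd \<rho>"
    then show "\<rho> \<in> half_plane"
      using preisach_triangle_le[OF _ assms, of \<rho>] by (auto simp: half_plane_def)
  qed
qed

lemma AE_configs:
  assumes "0 < a" "z \<in> configs a"
  shows "AE \<rho> in lebesgue_on (preisach_triangle a). z \<rho> = -1 \<or> z \<rho> = 1"
  using AE_half_plane[OF assms(1)] assms(2)
  by (auto elim!: eventually_mono simp: configs_def)

lemma measurable_configs:
  "z \<in> configs a \<Longrightarrow> z \<in> borel_measurable (lebesgue_on (preisach_triangle a))"
  by (simp add: configs_def)

lemma cdist_eq:
  "cdist a z1 z2 = (LINT \<rho>|lebesgue_on (preisach_triangle a). \<bar>z1 \<rho> - z2 \<rho>\<bar>)"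
  unfolding cdist_def set_lebesgue_integral_def
  by (subst integral_restrict_space) auto

lemma integrable_configs_diff:
  assumes "0 < a" "z1 \<in> configs a" "z2 \<in> configs a"
  shows "integrable (lebesgue_on (preisach_triangle a)) (\<lambda>\<rho>. \<bar>z1 \<rho> - z2 \<rho>\<bar>)"
    "integrable (lebesgue_on (preisach_triangle a)) (\<lambda>\<rho>. z1 \<rho> - z2 \<rho>)"
proof -
  note [measurable] = assms(2,3)[THEN measurable_configs]
  have "AE \<rho> in lebesgue_on (preisach_triangle a). \<bar>z1 \<rho> - z2 \<rho>\<bar> \<le> 2"
    using assms(2,3)[THEN AE_configs[OF assms(1)]] by eventually_elim auto
  then show "integrable (lebesgue_on (preisach_triangle a)) (\<lambda>\<rho>. z1 \<rho> - z2 \<rho>)"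
    by (intro finite_measure.integrable_const_bound[OF finite_measure_triangle]) auto
  then show "integrable (lebesgue_on (preisach_triangle a)) (\<lambda>\<rho>. \<bar>z1 \<rho> - z2 \<rho>\<bar>)"
    by simp
qed

lemma cdist_nonneg: "0 \<le> cdist a z1 z2"
  unfolding cdist_eq by (intro integral_nonneg_AE) auto

lemma cdist_commute: "cdist a z1 z2 = cdist a z2 z1"
  unfolding cdist_eq by (simp add: abs_minus_commute)

lemma cdist_triangle:
  assumes "0 < a" "z1 \<in> configs a" "z2 \<in> configs a" "z3 \<in> configs a"
  shows "cdist a z1 z3 \<le> cdist a z1 z2 + cdist a z2 z3"
proof -
  have "cdist a z1 z3 \<le>
      (LINT \<rho>|lebesgue_on (preisach_triangle a). \<bar>z1 \<rho> - z2 \<rho>\<bar> + \<bar>z2 \<rho> - z3 \<rho>\<bar>)"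
    unfolding cdist_eq
    by (intro integral_mono Bochner_Integration.integrable_add integrable_configs_diff assms) auto
  also have "\<dots> = cdist a z1 z2 + cdist a z2 z3"
    unfolding cdist_eq
    by (intro Bochner_Integration.integral_add integrable_configs_diff assms)
  finally show ?thesis .
qed

lemma cdist_le:
  assumes "0 < a" "z1 \<in> configs a" "z2 \<in> configs a"
  shows "cdist a z1 z2 \<le> 2 * measure lebesgue (preisach_triangle a)"
proof -
  interpret finite_measure "lebesgue_on (preisach_triangle a)" by (rule finite_measure_triangle)
  have "AE \<rho> in lebesgue_on (preisach_triangle a). \<bar>z1 \<rho> - z2 \<rho>\<bar> \<le> 2"
    using assms(2,3)[THEN AE_configs[OF assms(1)]] by eventually_elim auto
  then have "cdist a z1 z2 \<le> (LINT \<rho>|lebesgue_on (preisach_triangle a). 2)"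
    unfolding cdist_eq
    by (intro integral_mono_AE integrable_configs_diff assms) auto
  then show ?thesis
    by (simp add: measure_restrict_space)
qed

section \<open>Measurability of the relay output in the thresholds\<close>

text \<open>The value \<open>-1\<close> encodes that \<open>c\<close> is not attained.\<close>

definition last_hit :: "real \<Rightarrow> (real \<Rightarrow> real) \<Rightarrow> real \<Rightarrow> real" where
  "last_hit T u c = Sup (insert (-1) {s \<in> {0..T}. u s = c})"

lemma last_hit:
  assumes "continuous_on {0..T} u"
  shows "{s \<in> {0..T}. u s = c} = {} \<Longrightarrow> last_hit T u c = -1"
    and "s \<in> {0..T} \<Longrightarrow> u s = c \<Longrightarrow>
      last_hit T u c \<in> {0..T} \<and> u (last_hit T u c) = c \<and> s \<le> last_hit T u c"
proof -
  let ?X = "{s \<in> {0..T}. u s = c}"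
  show "?X = {} \<Longrightarrow> last_hit T u c = -1"
    by (simp only: last_hit_def) simp
  assume s: "s \<in> {0..T}" "u s = c"
  have "closed ?X"
    using continuous_closed_preimage_constant[OF assms] by (simp add: Collect_conj_eq)
  then have "compact ({0..T} \<inter> ?X)"
    by (intro compact_Int_closed) auto
  then have "compact ?X"
    by (rule back_subst[of compact]) auto
  then obtain m where m: "m \<in> ?X" "\<And>s. s \<in> ?X \<Longrightarrow> s \<le> m"
    using compact_attains_sup[of ?X] s by auto
  have "last_hit T u c = m"
    unfolding last_hit_def using m by (intro cSup_eq_maximum) auto
  then show "last_hit T u c \<in> {0..T} \<and> u (last_hit T u c) = c \<and> s \<le> last_hit T u c"
    using m s by auto
qed

text \<open>For \<open>b > -1\<close> the last hit of \<open>c\<close> is at least \<open>b\<close>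
  exactly if \<open>c\<close> is attained on \<open>{max 0 b..T}\<close>. So the superlevel set is
  the image of a compact interval under \<open>u\<close>, and compact.\<close>

lemma last_hit_measurable:
  assumes "continuous_on {0..T} u"
  shows "last_hit T u \<in> borel_measurable borel"
proof (subst borel_measurable_iff_ge, intro allI)
  fix b
  have ge: "-1 \<le> last_hit T u c" for c
  proof (cases "{s \<in> {0..T}. u s = c} = {}")
    case True
    then show ?thesis using last_hit(1)[OF assms] by simp
  next
    case False
    then obtain s where "s \<in> {0..T}" "u s = c" by auto
    from last_hit(2)[OF assms this] show ?thesis by auto
  qed
  show "{c \<in> space borel. b \<le> last_hit T u c} \<in> sets borel"
  proof (cases "b \<le> -1")
    case True
    then have "{c \<in> space borel. b \<le> last_hit T u c} = UNIV"
      using ge order_trans by auto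
    then show ?thesis by (simp only: sets.top space_borel sets_borel sets.top) simp
  next
    case False
    have "{c \<in> space borel. b \<le> last_hit T u c} = u ` {max 0 b..T}"
    proof (intro equalityI subsetI)
      fix c assume c: "c \<in> {c \<in> space borel. b \<le> last_hit T u c}"
      then have "{s \<in> {0..T}. u s = c} \<noteq> {}"
        using False last_hit(1)[OF assms, of c] by auto
      then obtain s where "s \<in> {0..T}" "u s = c" by auto
      from last_hit(2)[OF assms this] c show "c \<in> u ` {max 0 b..T}"
        by (intro image_eqI[of _ _ "last_hit T u c"]) auto
    next
      fix c assume "c \<in> u ` {max 0 b..T}"
      then obtain s where "s \<in> {0..T}" "u s = c" "b \<le> s" by auto
      with last_hit(2)[OF assms, of s c] show "c \<in> {c \<in> space borel. b \<le> last_hit T u c}"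
        by auto
    qed
    moreover have "compact (u ` {max 0 b..T})"
      by (intro compact_continuous_image continuous_on_subset[OF assms]) auto
    ultimately show ?thesis
      by (simp add: borel_compact)
  qed
qed

text \<open>The output is decided by which threshold was attained later, and the two last hits
  cannot coincide because the thresholds differ. This expresses the dependence on
  \<open>\<rho>\<close> by one function of a single real variable, applied to each
  threshold.\<close>

lemma relay_last_hit:
  assumes "continuous_on {0..T} u" "fst \<rho> < snd \<rho>"
  shows "relay \<rho> u \<zeta> T =
    (if last_hit T u (fst \<rho>) = -1 \<and> last_hit T u (snd \<rho>) = -1 then \<zeta>
     else if last_hit T u (snd \<rho>) < last_hit T u (fst \<rho>) then -1 else 1)"
proof -
  let ?g = "last_hit T u"
  let ?L = "\<lambda>c. {s \<in> {0..T}. u s = c}"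
  define X where "X = {s \<in> {0..T}. u s = fst \<rho> \<or> u s = snd \<rho>}"
  have relay: "relay \<rho> u \<zeta> T = (if X = {} then \<zeta> else if u (Sup X) = fst \<rho> then -1 else 1)"
    by (simp only: relay_def X_def Let_def)
  have dichotomy: "?L c = {} \<and> ?g c = -1 \<or> ?g c \<in> ?L c \<and> (\<forall>s\<in>?L c. s \<le> ?g c)" for c
    using last_hit(1)[OF assms(1), of c] last_hit(2)[OF assms(1), of _ c] by blast
  have ub: "s \<le> ?g c" if "s \<in> ?L c" for s c
    using dichotomy[of c] that by blast
  have X: "X = ?L (fst \<rho>) \<union> ?L (snd \<rho>)"
    by (auto simp: X_def)
  consider "X = {}" "?g (fst \<rho>) = -1" "?g (snd \<rho>) = -1"
    | "X \<noteq> {}" "?g (snd \<rho>) < ?g (fst \<rho>)" "?g (fst \<rho>) \<in> ?L (fst \<rho>)"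
    | "X \<noteq> {}" "?g (fst \<rho>) < ?g (snd \<rho>)" "?g (snd \<rho>) \<in> ?L (snd \<rho>)"
  proof -
    have neq: "?g (fst \<rho>) \<noteq> ?g (snd \<rho>)" if "?g (fst \<rho>) \<in> ?L (fst \<rho>)" "?g (snd \<rho>) \<in> ?L (snd \<rho>)"
      using that assms(2) by auto
    \<comment> \<open>The default \<open>-1\<close> lies before every possible hit, so a threshold
      that is never attained loses the comparison.\<close>
    have nonneg: "?g c \<in> ?L c \<Longrightarrow> -1 < ?g c" for c by auto
    have ne: "?g c \<in> ?L c \<Longrightarrow> c = fst \<rho> \<or> c = snd \<rho> \<Longrightarrow> X \<noteq> {}" for c
      unfolding X by blast
    show thesis
    proof (cases "?L (fst \<rho>) = {}"; cases "?L (snd \<rho>) = {}")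
      assume "?L (fst \<rho>) = {}" "?L (snd \<rho>) = {}"
      then show thesis
        using that(1) dichotomy[of "fst \<rho>"] dichotomy[of "snd \<rho>"] unfolding X by blast
    next
      assume *: "?L (fst \<rho>) = {}" "?L (snd \<rho>) \<noteq> {}"
      then have "?g (snd \<rho>) \<in> ?L (snd \<rho>)" "?g (fst \<rho>) = -1"
        using dichotomy[of "fst \<rho>"] dichotomy[of "snd \<rho>"] by blast+
      with nonneg ne that(3) show thesis by metis
    next
      assume *: "?L (fst \<rho>) \<noteq> {}" "?L (snd \<rho>) = {}"
      then have "?g (fst \<rho>) \<in> ?L (fst \<rho>)" "?g (snd \<rho>) = -1"
        using dichotomy[of "fst \<rho>"] dichotomy[of "snd \<rho>"] by blast+
      with nonneg ne that(2) show thesis by metis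
    next
      assume *: "?L (fst \<rho>) \<noteq> {}" "?L (snd \<rho>) \<noteq> {}"
      then have "?g (fst \<rho>) \<in> ?L (fst \<rho>)" "?g (snd \<rho>) \<in> ?L (snd \<rho>)"
        using dichotomy[of "fst \<rho>"] dichotomy[of "snd \<rho>"] by blast+
      with neq ne that(2,3) show thesis by (metis linorder_neqE_linordered_idom)
    qed
  qed
  then show ?thesis
  proof cases
    case 1
    then show ?thesis using relay by simp
  next
    case 2
    have "Sup X = ?g (fst \<rho>)"
    proof (rule cSup_eq_maximum)
      show "?g (fst \<rho>) \<in> X" using 2(3) X by blast
      show "s \<le> ?g (fst \<rho>)" if "s \<in> X" for s
        using that X ub[of s "fst \<rho>"] ub[of s "snd \<rho>"] 2(2) by fastforce
    qed
    then show ?thesis using relay 2 by auto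
  next
    case 3
    have "Sup X = ?g (snd \<rho>)"
    proof (rule cSup_eq_maximum)
      show "?g (snd \<rho>) \<in> X" using 3(3) X by blast
      show "s \<le> ?g (snd \<rho>)" if "s \<in> X" for s
        using that X ub[of s "fst \<rho>"] ub[of s "snd \<rho>"] 3(2) by fastforce
    qed
    then show ?thesis using relay 3 assms(2) by auto
  qed
qed

lemma virgin_measurable [measurable]: "virgin \<in> borel_measurable borel"
  unfolding virgin_def restrict_def by measurable

text \<open>Supplies the measurability in \<open>\<rho>\<close> that is part of
  \<open>configs\<close> but not of \<open>states\<close>: by \<open>relay_last_hit\<close> the
  configuration is built from Borel functions of the thresholds.\<close>

lemma states_subset_configs: "states T \<subseteq> configs a"
proof
  fix z assume "z \<in> states T"
  then obtain u where z: "z = (\<lambda>\<rho>\<in>half_plane. relay \<rho> u (virgin \<rho>) T)" and u: "continuous_on {0..T} u"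
    by (auto simp: states_def)
  have *: "z = (\<lambda>\<rho>\<in>half_plane.
    (if last_hit T u (fst \<rho>) = -1 \<and> last_hit T u (snd \<rho>) = -1 then virgin \<rho>
     else if last_hit T u (snd \<rho>) < last_hit T u (fst \<rho>) then -1 else 1))"
    unfolding z by (rule restrict_ext) (auto simp: half_plane_def relay_last_hit[OF u])
  have [measurable]: "last_hit T u \<in> borel_measurable borel"
    by (rule last_hit_measurable[OF u])
  have "z \<in> borel_measurable borel"
    unfolding * restrict_def by measurable
  moreover have "z \<in> half_plane \<rightarrow>\<^sub>E {-1, 1}"
    unfolding * by (auto simp: virgin_def)
  ultimately show "z \<in> configs a"
    by (simp add: configs_def borel_measurable_lebesgue_on_borel)
qed

lemma lip_states_subset_configs: "lip_states T L \<subseteq> configs a"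
proof -
  have "lip_states T L \<subseteq> states T"
    unfolding lip_states_def states_def by (auto intro: lipschitz_on_continuous_on)
  then show ?thesis using states_subset_configs by blast
qed


section \<open>Explicit form of the relay output after a monotone input\<close>

lemma shift_up:
  assumes "u < v" "\<rho> \<in> half_plane"
  shows "shift u v z \<rho> =
    (if snd \<rho> \<in> {u..v} then 1 else if fst \<rho> \<in> {u..v} then -1 else z \<rho>)"
proof -
  define P where "P = (\<lambda>s. (1 - s) * u + s * v)"
  define X where "X = {s \<in> {0..1}. P s = fst \<rho> \<or> P s = snd \<rho>}"
  have less: "fst \<rho> < snd \<rho>" using assms(2) by (simp add: half_plane_def)
  have p: "P s = c \<longleftrightarrow> s = (c - u) / (v - u)" for s c
    using assms(1) by (auto simp: P_def field_simps)
  have mem: "(c - u) / (v - u) \<in> {0..1} \<longleftrightarrow> c \<in> {u..v}" for c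
    using assms(1) by (auto simp: field_simps)
  \<comment> \<open>The times, possibly outside \<open>{0..1}\<close>, at which the affine input
    reaches the lower and the upper threshold. Each value is reached once, and for increasing input
    the upper threshold is reached later and decides the output.\<close>
  define A where "A = (fst \<rho> - u) / (v - u)"
  define B where "B = (snd \<rho> - u) / (v - u)"
  note p = p[of _ "fst \<rho>", folded A_def] p[of _ "snd \<rho>", folded B_def]
  note mem = mem[of "fst \<rho>", folded A_def] mem[of "snd \<rho>", folded B_def]
  have X: "s \<in> X \<longleftrightarrow> s = A \<and> fst \<rho> \<in> {u..v} \<or> s = B \<and> snd \<rho> \<in> {u..v}" for s
    unfolding X_def mem_Collect_eq p using mem by metis
  have AB: "A < B" "P A = fst \<rho>" "P B = snd \<rho>"
    using less assms(1) p by (auto simp: A_def B_def divide_strict_right_mono)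
  have relay: "shift u v z \<rho> = (if X = {} then z \<rho> else if P (Sup X) = fst \<rho> then -1 else 1)"
    using assms(2) by (simp only: shift_def relay_def Let_def restrict_apply if_True X_def P_def)
  consider "snd \<rho> \<in> {u..v}" | "snd \<rho> \<notin> {u..v}" "fst \<rho> \<in> {u..v}"
    | "snd \<rho> \<notin> {u..v}" "fst \<rho> \<notin> {u..v}" by blast
  then show ?thesis
  proof cases
    case 1
    then have in_X: "B \<in> X"
      using X by blast
    then have "Sup X = B"
      using X AB(1) by (intro cSup_eq_maximum) auto
    then show ?thesis
      using relay in_X less 1 AB by auto
  next
    case 2
    then have "X = {A}"
      using X by blast
    then show ?thesis
      using relay 2 less AB by auto
  next
    case 3
    then have "X = {}"
      using X by blast
    then show ?thesis
      using relay 3 by auto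
  qed
qed

text \<open>The mirror image of \<open>shift_up\<close>: for decreasing input the lower threshold is
  reached later and takes precedence.\<close>

lemma shift_down:
  assumes "v < u" "\<rho> \<in> half_plane"
  shows "shift u v z \<rho> =
    (if fst \<rho> \<in> {v..u} then -1 else if snd \<rho> \<in> {v..u} then 1 else z \<rho>)"
proof -
  define P where "P = (\<lambda>s. (1 - s) * u + s * v)"
  define X where "X = {s \<in> {0..1}. P s = fst \<rho> \<or> P s = snd \<rho>}"
  have less: "fst \<rho> < snd \<rho>" using assms(2) by (simp add: half_plane_def)
  have p: "P s = c \<longleftrightarrow> s = (u - c) / (u - v)" for s c
    using assms(1) by (auto simp: P_def field_simps)
  have mem: "(u - c) / (u - v) \<in> {0..1} \<longleftrightarrow> c \<in> {v..u}" for c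
    using assms(1) by (auto simp: field_simps)
  define A where "A = (u - fst \<rho>) / (u - v)"
  define B where "B = (u - snd \<rho>) / (u - v)"
  note p = p[of _ "fst \<rho>", folded A_def] p[of _ "snd \<rho>", folded B_def]
  note mem = mem[of "fst \<rho>", folded A_def] mem[of "snd \<rho>", folded B_def]
  have X: "s \<in> X \<longleftrightarrow> s = A \<and> fst \<rho> \<in> {v..u} \<or> s = B \<and> snd \<rho> \<in> {v..u}" for s
    unfolding X_def mem_Collect_eq p using mem by metis
  have AB: "B < A" "P A = fst \<rho>" "P B = snd \<rho>"
    using less assms(1) p by (auto simp: A_def B_def divide_strict_right_mono)
  have relay: "shift u v z \<rho> = (if X = {} then z \<rho> else if P (Sup X) = fst \<rho> then -1 else 1)"
    using assms(2) by (simp only: shift_def relay_def Let_def restrict_apply if_True X_def P_def)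
  consider "fst \<rho> \<in> {v..u}" | "fst \<rho> \<notin> {v..u}" "snd \<rho> \<in> {v..u}"
    | "snd \<rho> \<notin> {v..u}" "fst \<rho> \<notin> {v..u}" by blast
  then show ?thesis
  proof cases
    case 1
    then have in_X: "A \<in> X"
      using X by blast
    then have "Sup X = A"
      using X AB(1) by (intro cSup_eq_maximum) auto
    then show ?thesis
      using relay in_X less 1 AB by auto
  next
    case 2
    then have "X = {B}"
      using X by blast
    then show ?thesis
      using relay 2 less AB by auto
  next
    case 3
    then have "X = {}"
      using X by blast
    then show ?thesis
      using relay 3 by auto
  qed
qed

lemma shift_configs:
  assumes "z \<in> configs a" "u \<noteq> v"
  shows "shift u v z \<in> configs a"
proof -
  let ?M = "lebesgue_on (preisach_triangle a)"
  have z: "z \<in> half_plane \<rightarrow>\<^sub>E {-1, 1}"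
    using assms(1) by (simp add: configs_def)
  have [measurable]: "z \<in> borel_measurable ?M"
    using assms(1) by (simp add: configs_def)
  have [measurable]: "fst \<in> borel_measurable ?M" "snd \<in> borel_measurable ?M"
    by (auto intro!: borel_measurable_lebesgue_on_borel)
  have "Measurable.pred ?M (\<lambda>\<rho>. fst \<rho> < snd \<rho>)"
    by measurable
  then have [measurable]: "Measurable.pred ?M (\<lambda>\<rho>. \<rho> \<in> half_plane)"
    by (simp add: half_plane_def)
  consider "u < v" | "v < u" using assms(2) by linarith
  then have "shift u v z \<in> borel_measurable ?M \<and> (\<forall>\<rho>\<in>half_plane. shift u v z \<rho> \<in> {-1, 1})"
  proof cases
    case 1
    have "shift u v z = (\<lambda>\<rho>\<in>half_plane.
        if snd \<rho> \<in> {u..v} then 1 else if fst \<rho> \<in> {u..v} then -1 else z \<rho>)"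
      using shift_up[OF 1] by (auto simp: shift_def)
    moreover have "\<dots> \<in> borel_measurable ?M"
      unfolding restrict_def by measurable
    ultimately show ?thesis using z shift_up[OF 1] by auto
  next
    case 2
    have "shift u v z = (\<lambda>\<rho>\<in>half_plane.
        if fst \<rho> \<in> {v..u} then -1 else if snd \<rho> \<in> {v..u} then 1 else z \<rho>)"
      using shift_down[OF 2] by (auto simp: shift_def)
    moreover have "\<dots> \<in> borel_measurable ?M"
      unfolding restrict_def by measurable
    ultimately show ?thesis using z shift_down[OF 2] by auto
  qed
  moreover have "shift u v z \<in> extensional half_plane"
    by (simp add: shift_def)
  ultimately show ?thesis by (auto simp: configs_def PiE_iff)
qed

definition compatible_state :: "real \<Rightarrow> state \<Rightarrow> bool" where
  "compatible_state a s \<longleftrightarrow> (AE \<rho> in lebesgue_on (preisach_triangle a). (fst s, snd s \<rho>) \<in> relay_domain \<rho>)"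

text \<open>Compatibility of \<open>u\<close> and \<open>z\<close> absorbs the other cases of
  \<open>shift_up\<close>: relays with upper threshold at most \<open>u\<close> are already at
  \<open>1\<close>, those with lower threshold at least \<open>u\<close> already at
  \<open>-1\<close>. What remains depends on \<open>v\<close> through one threshold only.\<close>

lemma AE_shift_up:
  assumes "0 < a" "z \<in> configs a" "compatible_state a (u, z)" "u < v"
  shows "AE \<rho> in lebesgue_on (preisach_triangle a).
    shift u v z \<rho> = (if snd \<rho> < v then 1 else z \<rho>)"
  using assms(3)[unfolded compatible_state_def] AE_half_plane[OF assms(1)] AE_snd_neq[of v a]
    AE_configs[OF assms(1,2)]
  by eventually_elim
    (use assms(4) in \<open>auto simp: shift_up relay_domain_def half_plane_def split: if_splits\<close>)

lemma AE_shift_down: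
  assumes "0 < a" "z \<in> configs a" "compatible_state a (u, z)" "v < u"
  shows "AE \<rho> in lebesgue_on (preisach_triangle a).
    shift u v z \<rho> = (if v < fst \<rho> then -1 else z \<rho>)"
  using assms(3)[unfolded compatible_state_def] AE_half_plane[OF assms(1)] AE_fst_neq[of v a]
    AE_configs[OF assms(1,2)]
  by eventually_elim
    (use assms(4) in \<open>auto simp: shift_down relay_domain_def half_plane_def split: if_splits\<close>)

lemma compatible_state_shift:
  assumes "0 < a" "z \<in> configs a" "compatible_state a (u, z)" "u \<noteq> v"
  shows "compatible_state a (v, shift u v z)"
proof -
  consider "u < v" | "v < u" using assms(4) by linarith
  then show ?thesis
  proof cases
    case 1
    show ?thesis
      unfolding compatible_state_def
      using AE_shift_up[OF assms(1-3) 1] assms(3)[unfolded compatible_state_def] AE_half_plane[OF assms(1)]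
        AE_snd_neq[of v a]
      by eventually_elim (use 1 in \<open>auto simp: relay_domain_def half_plane_def\<close>)
  next
    case 2
    show ?thesis
      unfolding compatible_state_def
      using AE_shift_down[OF assms(1-3) 2] assms(3)[unfolded compatible_state_def] AE_half_plane[OF assms(1)]
        AE_fst_neq[of v a]
      by eventually_elim (use 2 in \<open>auto simp: relay_domain_def half_plane_def\<close>)
  qed
qed

section \<open>The entropy condition for the Riemann solver\<close>

text \<open>The jump condition for a Kruzhkov-type pair, with jumps taken as left minus right. It is
  required for grid values \<open>k\<close> only, since a front may violate it for \<open>k\<close>
  strictly between its two values of \<open>u\<close>.\<close>

definition entropic :: "real \<Rightarrow> nat \<Rightarrow> state \<Rightarrow> real \<Rightarrow> state \<Rightarrow> bool" where
  "entropic a n l \<sigma> r \<longleftrightarrow> (\<forall>k\<in>grid n. \<forall>zh\<in>configs a. compatible_state a (k, zh) \<longrightarrow>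
     \<sigma> * ((\<bar>fst l - k\<bar> + cdist a (snd l) zh) - (\<bar>fst r - k\<bar> + cdist a (snd r) zh))
       \<le> \<bar>fst l - k\<bar> - \<bar>fst r - k\<bar>)"

text \<open>The invariant of the tracking: fans between admissible states contain only admissible
  states, and propagation creates no new ones.\<close>

definition admissible :: "real \<Rightarrow> nat \<Rightarrow> state \<Rightarrow> bool" where
  "admissible a n s \<longleftrightarrow> fst s \<in> grid n \<and> snd s \<in> configs a \<and> compatible_state a s"

lemma rh_speed_eq:
  "rh_speed a s s' = (fst s' - fst s) /
     (fst s' - fst s + (LINT \<rho>|lebesgue_on (preisach_triangle a). snd s' \<rho> - snd s \<rho>))"
  unfolding rh_speed_def set_lebesgue_integral_def
  by (subst integral_restrict_space) auto

text \<open>The arithmetic behind a moving front: \<open>\<delta>\<close> is the modulus of the jump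
  of \<open>u\<close>, \<open>\<kappa>\<close> the distance of the two configurations, and
  \<open>\<delta> / (\<delta> + \<kappa>)\<close> the front speed. In both alternatives the jump of
  the density is at most \<open>\<delta> + \<kappa>\<close> times the sign of
  \<open>ql - qr\<close>, with equality in the second.\<close>

lemma entropy_inequality:
  fixes \<delta> \<kappa> dl dr ql qr :: real
  assumes "0 < \<delta>" "0 \<le> \<kappa>" "dl \<le> dr + \<kappa>"
    and "ql - qr = \<delta> \<or> ql - qr = - \<delta> \<and> dl = dr - \<kappa>"
  shows "\<delta> / (\<delta> + \<kappa>) * ((ql + dl) - (qr + dr)) \<le> ql - qr"
proof -
  have "\<delta> + \<kappa> \<noteq> 0"
    using assms(1,2) by simp
  have "(ql + dl) - (qr + dr) \<le> (ql - qr) / \<delta> * (\<delta> + \<kappa>)"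
    using assms by auto
  then have "\<delta> / (\<delta> + \<kappa>) * ((ql + dl) - (qr + dr)) \<le> \<delta> / (\<delta> + \<kappa>) * ((ql - qr) / \<delta> * (\<delta> + \<kappa>))"
    using assms by (intro mult_left_mono) auto
  also have "\<dots> = ql - qr"
    using assms(1) \<open>\<delta> + \<kappa> \<noteq> 0\<close> by simp
  finally show ?thesis .
qed

text \<open>\<open>y\<close> is the common background, later the configuration at the right end of
  the fan. Relays switch only from \<open>-1\<close> to \<open>1\<close>, so the integral in the
  Rankine--Hugoniot speed is a distance. For \<open>k \<le> v\<close> the triangle inequality is
  enough, for \<open>v' \<le> k\<close> an equality is needed.\<close>

lemma entropic_up:
  assumes "0 < a" "v < v'" and configs: "z \<in> configs a" "z' \<in> configs a" "y \<in> configs a"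
    and z: "AE \<rho> in lebesgue_on (preisach_triangle a). z \<rho> = (if snd \<rho> < v then 1 else y \<rho>)"
    and z': "AE \<rho> in lebesgue_on (preisach_triangle a). z' \<rho> = (if snd \<rho> < v' then 1 else y \<rho>)"
    and grid: "\<And>k. k \<in> grid n \<Longrightarrow> k \<le> v \<or> v' \<le> k"
  shows "entropic a n (v', z') (rh_speed a (v, z) (v', z')) (v, z)"
proof -
  have "(LINT \<rho>|lebesgue_on (preisach_triangle a). z' \<rho> - z \<rho>) = cdist a z' z"
    unfolding cdist_eq
  proof (rule integral_cong_AE)
    show "AE \<rho> in lebesgue_on (preisach_triangle a). z' \<rho> - z \<rho> = \<bar>z' \<rho> - z \<rho>\<bar>"
      using z z' AE_configs[OF assms(1) configs(3)]
      by eventually_elim (use assms(2) in auto)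
  qed (use configs[THEN measurable_configs] in measurable)
  then have speed: "rh_speed a (v, z) (v', z') = (v' - v) / (v' - v + cdist a z' z)"
    by (simp add: rh_speed_eq)
  \<comment> \<open>A relay that switches has its upper threshold below \<open>v' \<le> k\<close>,
    so compatibility forces \<open>zh\<close> to be \<open>1\<close> there; everywhere else
    \<open>z\<close> and \<open>z'\<close> agree. Hence the distances add up.\<close>
  have eq: "cdist a z' zh = cdist a z zh - cdist a z' z"
    if "zh \<in> configs a" "compatible_state a (k, zh)" "v' \<le> k" for k zh
  proof -
    have "cdist a z zh = (LINT \<rho>|lebesgue_on (preisach_triangle a). \<bar>z' \<rho> - zh \<rho>\<bar> + \<bar>z' \<rho> - z \<rho>\<bar>)"
      unfolding cdist_eq
    proof (rule integral_cong_AE)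
      show "AE \<rho> in lebesgue_on (preisach_triangle a).
          \<bar>z \<rho> - zh \<rho>\<bar> = \<bar>z' \<rho> - zh \<rho>\<bar> + \<bar>z' \<rho> - z \<rho>\<bar>"
        using z z' AE_configs[OF assms(1) configs(3)] that(2)[unfolded compatible_state_def]
        by eventually_elim (use assms(2) that(3) in \<open>auto simp: relay_domain_def\<close>)
    qed (use configs[THEN measurable_configs] that(1)[THEN measurable_configs] in measurable)
    also have "\<dots> = cdist a z' zh + cdist a z' z"
      unfolding cdist_eq
      by (intro Bochner_Integration.integral_add integrable_configs_diff assms that)
    finally show ?thesis by simp
  qed
  show ?thesis
    unfolding entropic_def speed fst_conv snd_conv
  proof (intro ballI impI)
    fix k zh assume k: "k \<in> grid n" and zh: "zh \<in> configs a" "compatible_state a (k, zh)"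
    have "\<bar>v' - k\<bar> - \<bar>v - k\<bar> = v' - v \<or> \<bar>v' - k\<bar> - \<bar>v - k\<bar> = - (v' - v) \<and> cdist a z' zh = cdist a z zh - cdist a z' z"
      using grid[OF k] eq[OF zh] assms(2) by auto
    moreover have "cdist a z' zh \<le> cdist a z zh + cdist a z' z"
      using cdist_triangle[OF assms(1) configs(2,1) zh(1)] by simp
    ultimately show "(v' - v) / (v' - v + cdist a z' z) * (\<bar>v' - k\<bar> + cdist a z' zh - (\<bar>v - k\<bar> + cdist a z zh))
        \<le> \<bar>v' - k\<bar> - \<bar>v - k\<bar>"
      using assms(2) by (intro entropy_inequality) (auto simp: cdist_nonneg)
  qed
qed

text \<open>The mirror image: relays switch from \<open>1\<close> to \<open>-1\<close>, and those
  that do have a lower threshold above \<open>v'\<close>. For \<open>k \<le> v'\<close>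
  compatibility makes \<open>zh\<close> equal to \<open>-1\<close> there.\<close>

lemma entropic_down:
  assumes "0 < a" "v' < v" and configs: "z \<in> configs a" "z' \<in> configs a" "y \<in> configs a"
    and z: "AE \<rho> in lebesgue_on (preisach_triangle a). z \<rho> = (if v < fst \<rho> then -1 else y \<rho>)"
    and z': "AE \<rho> in lebesgue_on (preisach_triangle a). z' \<rho> = (if v' < fst \<rho> then -1 else y \<rho>)"
    and grid: "\<And>k. k \<in> grid n \<Longrightarrow> k \<le> v' \<or> v \<le> k"
  shows "entropic a n (v', z') (rh_speed a (v, z) (v', z')) (v, z)"
proof -
  have "(LINT \<rho>|lebesgue_on (preisach_triangle a). z' \<rho> - z \<rho>) =
      (LINT \<rho>|lebesgue_on (preisach_triangle a). - \<bar>z' \<rho> - z \<rho>\<bar>)"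
  proof (rule integral_cong_AE)
    show "AE \<rho> in lebesgue_on (preisach_triangle a). z' \<rho> - z \<rho> = - \<bar>z' \<rho> - z \<rho>\<bar>"
      using z z' AE_configs[OF assms(1) configs(3)]
      by eventually_elim (use assms(2) in auto)
  qed (use configs[THEN measurable_configs] in measurable)
  then have "rh_speed a (v, z) (v', z') = (v' - v) / (v' - v - cdist a z' z)"
    by (simp add: rh_speed_eq cdist_eq)
  \<comment> \<open>Numerator and denominator are both negative, so the speed is again positive and
    \<open>entropy_inequality\<close> applies with \<open>v - v'\<close> as the jump.\<close>
  also have "\<dots> = - (v - v') / - (v - v' + cdist a z' z)"
    by simp
  also have "\<dots> = (v - v') / (v - v' + cdist a z' z)"
    by (rule minus_divide_divide)
  finally have speed: "rh_speed a (v, z) (v', z') = (v - v') / (v - v' + cdist a z' z)" .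
  have eq: "cdist a z' zh = cdist a z zh - cdist a z' z"
    if "zh \<in> configs a" "compatible_state a (k, zh)" "k \<le> v'" for k zh
  proof -
    have "cdist a z zh = (LINT \<rho>|lebesgue_on (preisach_triangle a). \<bar>z' \<rho> - zh \<rho>\<bar> + \<bar>z' \<rho> - z \<rho>\<bar>)"
      unfolding cdist_eq
    proof (rule integral_cong_AE)
      show "AE \<rho> in lebesgue_on (preisach_triangle a).
          \<bar>z \<rho> - zh \<rho>\<bar> = \<bar>z' \<rho> - zh \<rho>\<bar> + \<bar>z' \<rho> - z \<rho>\<bar>"
        using z z' AE_configs[OF assms(1) configs(3)] that(2)[unfolded compatible_state_def]
        by eventually_elim (use assms(2) that(3) in \<open>auto simp: relay_domain_def\<close>)
    qed (use configs[THEN measurable_configs] that(1)[THEN measurable_configs] in measurable)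
    also have "\<dots> = cdist a z' zh + cdist a z' z"
      unfolding cdist_eq
      by (intro Bochner_Integration.integral_add integrable_configs_diff assms that)
    finally show ?thesis by simp
  qed
  show ?thesis
    unfolding entropic_def speed fst_conv snd_conv
  proof (intro ballI impI)
    fix k zh assume k: "k \<in> grid n" and zh: "zh \<in> configs a" "compatible_state a (k, zh)"
    have "\<bar>v' - k\<bar> - \<bar>v - k\<bar> = v - v' \<or> \<bar>v' - k\<bar> - \<bar>v - k\<bar> = - (v - v') \<and> cdist a z' zh = cdist a z zh - cdist a z' z"
      using grid[OF k] eq[OF zh] assms(2) by auto
    moreover have "cdist a z' zh \<le> cdist a z zh + cdist a z' z"
      using cdist_triangle[OF assms(1) configs(2,1) zh(1)] by simp
    ultimately show "(v - v') / (v - v' + cdist a z' z) * (\<bar>v' - k\<bar> + cdist a z' zh - (\<bar>v - k\<bar> + cdist a z zh))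
        \<le> \<bar>v' - k\<bar> - \<bar>v - k\<bar>"
      using assms(2) by (intro entropy_inequality) (auto simp: cdist_nonneg)
  qed
qed

lemma grid_add_int: "v \<in> grid n \<Longrightarrow> v + of_int i / 2 ^ n \<in> grid n"
  by (auto simp: grid_def add_divide_distrib[symmetric] simp flip: of_int_add)

lemma grid_gap:
  assumes "v \<in> grid n" "k \<in> grid n"
  shows "k \<le> v \<or> v + 1 / 2 ^ n \<le> k"
proof -
  obtain i j where "v = of_int i / 2 ^ n" "k = of_int j / 2 ^ n"
    using assms by (auto simp: grid_def)
  moreover have "j \<le> i \<or> i + 1 \<le> j" by linarith
  then have "real_of_int j \<le> real_of_int i \<or> real_of_int i + 1 \<le> real_of_int j"
    by linarith
  ultimately show ?thesis
    by (auto simp: add_divide_distrib[symmetric] divide_right_mono)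
qed

lemma intermediate_in_grid:
  assumes "ur \<in> grid n"
  shows "intermediate n ul ur j \<in> grid n"
  using grid_add_int[OF assms, of "sgn (int j) * int j"] grid_add_int[OF assms, of "- int j"] assms
  by (cases "j = 0") (auto simp: intermediate_def sgn_if)

abbreviation fan_state :: "nat \<Rightarrow> real \<Rightarrow> state \<Rightarrow> nat \<Rightarrow> state" where
  "fan_state n ul r j \<equiv> (intermediate n ul (fst r) j, intermediate_config n ul r j)"

lemma fan_state_0 [simp]: "fan_state n ul r 0 = r"
  by (simp add: intermediate_def intermediate_config_def)

lemma admissible_fan_state:
  assumes "0 < a" "admissible a n r" "ul \<noteq> fst r"
  shows "admissible a n (fan_state n ul r j)"
proof (cases "j = 0")
  case True
  then show ?thesis using assms(2) fan_state_0[of n ul r] by metis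
next
  case False
  then have "fst r \<noteq> intermediate n ul (fst r) j"
    using assms(3) by (auto simp: intermediate_def sgn_if)
  then show ?thesis
    using assms(1,2) False intermediate_in_grid[of "fst r" n ul j]
    by (auto simp: admissible_def intermediate_config_def intro!: shift_configs compatible_state_shift)
qed

text \<open>One formula for all \<open>j\<close>, with the same background \<open>snd r\<close>, as
  \<open>entropic_up\<close> demands for consecutive states. For \<open>j = 0\<close> it holds
  because compatibility already puts the relays with upper threshold below \<open>fst r\<close> at
  \<open>1\<close>.\<close>

lemma AE_fan_state_up:
  assumes "0 < a" "admissible a n r" "fst r < ul"
  shows "AE \<rho> in lebesgue_on (preisach_triangle a). intermediate_config n ul r j \<rho> =
    (if snd \<rho> < intermediate n ul (fst r) j then 1 else snd r \<rho>)"
proof (cases "j = 0")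
  case True
  have "AE \<rho> in lebesgue_on (preisach_triangle a). (fst r, snd r \<rho>) \<in> relay_domain \<rho>"
    using assms(2) by (simp add: admissible_def compatible_state_def)
  then show ?thesis
    by eventually_elim (use True in \<open>auto simp: intermediate_def intermediate_config_def relay_domain_def\<close>)
next
  case False
  then have "fst r < intermediate n ul (fst r) j"
    using assms(3) by (auto simp: intermediate_def sgn_if)
  from AE_shift_up[OF assms(1) _ _ this, of "snd r"] show ?thesis
    using assms(2) False by (simp add: admissible_def intermediate_config_def)
qed

lemma AE_fan_state_down:
  assumes "0 < a" "admissible a n r" "ul < fst r"
  shows "AE \<rho> in lebesgue_on (preisach_triangle a). intermediate_config n ul r j \<rho> =
    (if intermediate n ul (fst r) j < fst \<rho> then -1 else snd r \<rho>)"
proof (cases "j = 0")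
  case True
  have "AE \<rho> in lebesgue_on (preisach_triangle a). (fst r, snd r \<rho>) \<in> relay_domain \<rho>"
    using assms(2) by (simp add: admissible_def compatible_state_def)
  then show ?thesis
    by eventually_elim (use True in \<open>auto simp: intermediate_def intermediate_config_def relay_domain_def\<close>)
next
  case False
  then have "intermediate n ul (fst r) j < fst r"
    using assms(3) by (auto simp: intermediate_def sgn_if)
  from AE_shift_down[OF assms(1) _ _ this, of "snd r"] show ?thesis
    using assms(2) False by (simp add: admissible_def intermediate_config_def)
qed

lemma entropic_fan:
  assumes "0 < a" "admissible a n r" "ul \<noteq> fst r"
  defines "S \<equiv> fan_state n ul r"
  shows "entropic a n (S (Suc j)) (rh_speed a (S j) (S (Suc j))) (S j)"
proof -
  have configs: "snd (S j) \<in> configs a" "snd (S (Suc j)) \<in> configs a" "snd r \<in> configs a"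
    using admissible_fan_state[OF assms(1-3)] assms(2) by (auto simp: admissible_def S_def)
  have grid: "fst (S j) \<in> grid n" "fst (S (Suc j)) \<in> grid n"
    using admissible_fan_state[OF assms(1-3)] by (auto simp: admissible_def S_def)
  consider "fst r < ul" | "ul < fst r" using assms(3) by linarith
  then show ?thesis
  proof cases
    case 1
    then have step: "intermediate n ul (fst r) (Suc j) = intermediate n ul (fst r) j + 1 / 2 ^ n"
      by (simp add: intermediate_def add_divide_distrib)
    then have less: "intermediate n ul (fst r) j < intermediate n ul (fst r) (Suc j)"
      by simp
    show ?thesis
      unfolding S_def
    proof (rule entropic_up[OF assms(1) less configs[unfolded S_def snd_conv]
          AE_fan_state_up[OF assms(1,2) 1] AE_fan_state_up[OF assms(1,2) 1]])
      show "k \<le> intermediate n ul (fst r) j \<or> intermediate n ul (fst r) (Suc j) \<le> k" if "k \<in> grid n" for k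
        using grid_gap[OF _ that, of "fst (S j)"] grid(1) by (simp add: S_def step)
    qed
  next
    case 2
    then have step: "intermediate n ul (fst r) j = intermediate n ul (fst r) (Suc j) + 1 / 2 ^ n"
      by (simp add: intermediate_def add_divide_distrib diff_divide_distrib)
    then have less: "intermediate n ul (fst r) (Suc j) < intermediate n ul (fst r) j"
      by simp
    show ?thesis
      unfolding S_def
    proof (rule entropic_down[OF assms(1) less configs[unfolded S_def snd_conv]
          AE_fan_state_down[OF assms(1,2) 2] AE_fan_state_down[OF assms(1,2) 2]])
      show "k \<le> intermediate n ul (fst r) (Suc j) \<or> intermediate n ul (fst r) j \<le> k" if "k \<in> grid n" for k
        using grid_gap[OF _ that, of "fst (S (Suc j))"] grid(2) by (simp add: S_def step)
    qed
  qed
qed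

section \<open>Chains of fronts and the Riemann fan\<close>

lemma chain_mono:
  assumes "chain P s ps" "\<And>l \<sigma> r. P l \<sigma> r \<Longrightarrow> Q l \<sigma> r"
  shows "chain Q s ps"
  using assms by (induction ps arbitrary: s) auto

lemma chain_append:
  "chain Q s (xs @ ys) \<longleftrightarrow>
     chain Q s xs \<and> chain Q (if xs = [] then s else snd (snd (last xs))) ys"
  by (induction xs arbitrary: s) auto

text \<open>Fans are listed with decreasing index, so the state to the left of front
  \<open>j\<close> is \<open>S (Suc j)\<close>: the right state of the preceding entry or, for the
  first one, \<open>S m\<close>.\<close>

lemma chain_rev_upt:
  assumes "\<And>j. j < m \<Longrightarrow> Q (S (Suc j)) (\<sigma> j) (S j)"
  shows "chain Q (S m) (map (\<lambda>j. (y, \<sigma> j, S j)) (rev [0..<m]))"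
  using assms by (induction m) auto

text \<open>Besides the jump conditions this collects what is needed to concatenate fans: a nonempty
  fan whose last state is \<open>r\<close> hands \<open>r\<close> on as the left state of the next
  one.\<close>

lemma riemann_fan:
  fixes y :: real
  assumes "0 < a" "admissible a n l" "admissible a n r" "l \<noteq> r"
  defines "F \<equiv> map (\<lambda>(\<sigma>, s). (y, \<sigma>, s)) (riemann_fan a n l r)"
  shows "chain (entropic a n) l F" "F \<noteq> []" "snd (snd (last F)) = r"
    "\<And>p. p \<in> set F \<Longrightarrow> admissible a n (snd (snd p))"
proof -
  define S where "S = fan_state n (fst l) r"
  define m where "m = nat \<lfloor>\<bar>fst l - fst r\<bar> * 2 ^ n\<rfloor>"
  define P where "P = (if snd l \<noteq> snd (S m) then [(y, 0 :: real, (fst l, snd (S m)))] else [])"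
  define G where "G = map (\<lambda>j. (y, rh_speed a (S j) (S (Suc j)), S j)) (rev [0..<m])"
  have F: "F = P @ G"
    by (simp add: F_def P_def G_def riemann_fan_def Let_def S_def m_def comp_def)
  have S0: "S 0 = r" by (simp add: S_def del: fan_state_0) (metis fan_state_0)
  \<comment> \<open>Both values are integer multiples of the grid size, so the floor in the number
    of fronts is exact and the fan ends precisely at \<open>fst l\<close>.\<close>
  obtain i j where ij: "fst l = of_int i / 2 ^ n" "fst r = of_int j / 2 ^ n"
    using assms(2,3) by (auto simp: admissible_def grid_def)
  have m: "m = nat \<bar>i - j\<bar>"
    unfolding m_def ij
    by (simp add: diff_divide_distrib[symmetric] abs_divide flip: of_int_diff of_int_abs)
  then have m_real: "real m = \<bar>of_int i - of_int j\<bar>"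
    by simp
  have fst_Sm: "fst (S m) = fst l"
    by (auto simp: S_def intermediate_def m_real ij sgn_if add_divide_distrib[symmetric] divide_less_cancel abs_if field_simps)
  have m0: "m = 0 \<longleftrightarrow> fst l = fst r"
    using m by (simp add: ij)
  \<comment> \<open>If there is no moving front, the values of \<open>u\<close> coincide and
    \<open>admissible_fan_state\<close> does not apply; then only \<open>S 0 = r\<close>
    occurs.\<close>
  have admissible_S: "admissible a n (S j)" if "j \<le> m" for j
  proof (cases "m = 0")
    case True
    then show ?thesis using that S0 assms(3) by simp
  next
    case False
    then show ?thesis using admissible_fan_state[OF assms(1,3)] m0 by (simp add: S_def)
  qed
  have Sm: "(fst l, snd (S m)) = S m"
    using fst_Sm by (metis prod.collapse)
  have "chain (entropic a n) (S m) G"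
    unfolding G_def using entropic_fan[OF assms(1,3)] m0
    by (intro chain_rev_upt) (auto simp: S_def)
  \<comment> \<open>The stationary front: the speed is zero and \<open>u\<close> does not jump, so
    both sides of the inequality vanish whatever the configurations are.\<close>
  moreover have "entropic a n l 0 (S m)"
    using fst_Sm by (simp add: entropic_def)
  moreover have "l = S m" if "snd l = snd (S m)"
    using that fst_Sm by (metis prod.collapse)
  ultimately show "chain (entropic a n) l F"
    unfolding F P_def Sm by auto
  show "F \<noteq> []"
  proof
    assume "F = []"
    then have "snd l = snd (S m)" "m = 0"
      by (auto simp: F P_def G_def split: if_splits)
    then have "l = r" using S0 fst_Sm by (metis prod.collapse)
    then show False using assms(4) by simp
  qed
  then show "snd (snd (last F)) = r"
    using S0 Sm by (cases "m = 0") (auto simp: F P_def G_def last_map last_rev split: if_splits)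
  show "\<And>p. p \<in> set F \<Longrightarrow> admissible a n (snd (snd p))"
    using admissible_S Sm by (auto simp: F P_def G_def split: if_splits)
qed


section \<open>Step functions and the fronts of a whole profile\<close>

lemma step_function_left_value:
  fixes f :: "real \<Rightarrow> 'b"
  assumes "step_function f"
  shows "\<exists>x0<y. \<forall>x. x0 < x \<and> x < y \<longrightarrow> f x = left_value f y"
proof -
  obtain D where D: "finite D" "\<And>x y. x \<le> y \<Longrightarrow> D \<inter> {x<..y} = {} \<Longrightarrow> f x = f y"
    using assms(1) unfolding step_function_def by blast
  obtain x0 where x0: "x0 < y" "D \<inter> {x0<..<y} = {}"
  proof -
    \<comment> \<open>The last possible discontinuity before \<open>y\<close>; inserting
      \<open>y - 1\<close> covers the case that there is none.\<close>
    define x0 where "x0 = Max (insert (y - 1) (D \<inter> {..<y}))"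
    have "x0 < y" "\<And>d. d \<in> D \<Longrightarrow> d < y \<Longrightarrow> d \<le> x0"
      using D(1) by (auto simp: x0_def)
    then show thesis using that[of x0] by force
  qed
  define c where "c = f ((x0 + y) / 2)"
  have c: "f x = c" if "x0 < x" "x < y" for x
  proof (cases "x \<le> (x0 + y) / 2")
    case True
    then have "D \<inter> {x<..(x0 + y) / 2} = {}" using x0 that by fastforce
    then show ?thesis using D(2)[OF True] by (simp add: c_def)
  next
    case False
    then have "D \<inter> {(x0 + y) / 2<..x} = {}" using x0 that by fastforce
    then show ?thesis using D(2)[of "(x0 + y) / 2" x] False by (simp add: c_def)
  qed
  have ev: "\<forall>\<^sub>F x in at_left y. f x = c"
    using c x0(1) by (auto simp: eventually_at_left_field)
  \<comment> \<open>The definite description denotes because the left filter is nontrivial, so two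
    eventual values must agree.\<close>
  have "left_value f y = c"
    unfolding left_value_def
  proof (rule the_equality[where P = "\<lambda>s. \<forall>\<^sub>F x in at_left y. f x = s", OF ev])
    fix s assume "\<forall>\<^sub>F x in at_left y. f x = s"
    with ev have "\<forall>\<^sub>F x in at_left y. s = c"
      by eventually_elim simp
    then show "s = c" by simp
  qed
  then show ?thesis using c x0(1) by auto
qed

lemma step_function_minus_infinity:
  fixes f :: "real \<Rightarrow> 'b"
  assumes "step_function f"
  shows "\<exists>x0. \<forall>x\<le>x0. f x = value_at_minus_infinity f"
proof -
  obtain D where D: "finite D" "\<And>x y. x \<le> y \<Longrightarrow> D \<inter> {x<..y} = {} \<Longrightarrow> f x = f y"
    using assms(1) unfolding step_function_def by blast
  define x0 where "x0 = Min (insert 0 D) - 1"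
  have gt: "x0 < d" if "d \<in> D" for d
  proof -
    have "Min (insert 0 D) \<le> d" using D(1) that by (intro Min_le) auto
    then show ?thesis by (simp add: x0_def)
  qed
  have c: "f x = f x0" if "x \<le> x0" for x
    using that by (rule D(2)) (use gt in fastforce)
  have ev: "\<forall>\<^sub>F x in at_bot. f x = f x0"
    unfolding eventually_at_bot_linorder using c by blast
  have "value_at_minus_infinity f = f x0"
    unfolding value_at_minus_infinity_def
  proof (rule the_equality[where P = "\<lambda>s. \<forall>\<^sub>F x in at_bot. f x = s", OF ev])
    fix s assume "\<forall>\<^sub>F x in at_bot. f x = s"
    with ev have "\<forall>\<^sub>F x in (at_bot :: real filter). s = f x0"
      by eventually_elim simp
    then show "s = f x0" by simp
  qed
  then show ?thesis using c by metis
qed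

lemma finite_jumps:
  fixes f :: "real \<Rightarrow> 'b"
  assumes "step_function f"
  shows "finite (jumps f)"
proof -
  obtain D where D: "finite D" "\<And>x y. x \<le> y \<Longrightarrow> D \<inter> {x<..y} = {} \<Longrightarrow> f x = f y"
    using assms(1) unfolding step_function_def by blast
  have "left_value f y = f y" if "y \<notin> D" for y
  proof -
    obtain x0 where x0: "x0 < y" "\<And>x. x0 < x \<Longrightarrow> x < y \<Longrightarrow> f x = left_value f y"
      using step_function_left_value[OF assms] by blast
    define x where "x = (Max (insert x0 (D \<inter> {..<y})) + y) / 2"
    have "x0 < x" "x < y" and le: "\<And>d. d \<in> D \<Longrightarrow> d < y \<Longrightarrow> d < x"
    proof -
      let ?m = "Max (insert x0 (D \<inter> {..<y}))"
      have "?m < y" "x0 \<le> ?m" "\<And>d. d \<in> D \<Longrightarrow> d < y \<Longrightarrow> d \<le> ?m"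
        using D(1) x0(1) by auto
      then show "x0 < x" "x < y" "\<And>d. d \<in> D \<Longrightarrow> d < y \<Longrightarrow> d < x"
        by (fastforce simp: x_def)+
    qed
    moreover have "D \<inter> {x<..y} = {}"
      using le that by force
    ultimately show ?thesis
      using D(2)[of x y] x0(2) by auto
  qed
  then have "jumps f \<subseteq> D" by (auto simp: jumps_def)
  then show ?thesis using D(1) finite_subset by blast
qed

text \<open>The set \<open>D\<close> witnessing \<open>step_function\<close> may contain points that
  are not jumps. These are crossed one by one, from right to left, by induction on their number in
  the interval.\<close>

lemma step_function_const:
  fixes f :: "real \<Rightarrow> 'b"
  assumes "step_function f" "x \<le> y" "jumps f \<inter> {x<..y} = {}"
  shows "f x = f y"
proof -
  obtain D where D: "finite D" "\<And>x y. x \<le> y \<Longrightarrow> D \<inter> {x<..y} = {} \<Longrightarrow> f x = f y"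
    using assms(1) unfolding step_function_def by blast
  show ?thesis
    using assms(2,3)
  proof (induction "card (D \<inter> {x<..y})" arbitrary: y rule: less_induct)
    case less
    show ?case
    proof (cases "D \<inter> {x<..y} = {}")
      case True
      then show ?thesis using D(2) less.prems by blast
    next
      case False
      define d where "d = Max (D \<inter> {x<..y})"
      have d: "d \<in> D \<inter> {x<..y}"
        unfolding d_def using False D(1) by (intro Max_in) auto
      have "e \<le> d" if "e \<in> D \<inter> {x<..y}" for e
        unfolding d_def using that D(1) by (intro Max_ge) auto
      then have "D \<inter> {d<..y} = {}" using d by fastforce
      then have fy: "f d = f y" using D(2) d by auto
      obtain x0 where x0: "x0 < d" "\<And>x. x0 < x \<Longrightarrow> x < d \<Longrightarrow> f x = left_value f d"
        using step_function_left_value[OF assms(1)] by blast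
      \<comment> \<open>A point strictly before \<open>d\<close>, in the range where
        \<open>f\<close> equals its left value at \<open>d\<close>. Since \<open>d\<close> is no
        jump, \<open>f\<close> has the same value there, and the interval up to \<open>x'\<close>
        has lost the point \<open>d\<close>.\<close>
      define x' where "x' = (max x x0 + d) / 2"
      have x': "x < x'" "x' < d" "x0 < x'"
        using d x0(1) by (auto simp: x'_def)
      have "d \<notin> jumps f" using less.prems d by auto
      then have "f x' = f d" using x0(2) x' by (simp add: jumps_def)
      moreover have "d \<notin> D \<inter> {x<..x'}" "D \<inter> {x<..x'} \<subseteq> D \<inter> {x<..y}"
        using d x' by auto
      then have "D \<inter> {x<..x'} \<subset> D \<inter> {x<..y}"
        using d by blast
      then have "card (D \<inter> {x<..x'}) < card (D \<inter> {x<..y})"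
        using D(1) by (intro psubset_card_mono) auto
      then have "f x = f x'"
        using less.prems x' d by (intro less.hyps) auto
      ultimately show ?thesis using fy by simp
    qed
  qed
qed

lemma admissible_left_value:
  assumes "step_function f" "\<And>x. admissible a n (f x)"
  shows "admissible a n (left_value f y)"
proof -
  obtain x0 where "x0 < y" "\<And>x. x0 < x \<Longrightarrow> x < y \<Longrightarrow> f x = left_value f y"
    using step_function_left_value[OF assms(1)] by blast
  then have "f ((x0 + y) / 2) = left_value f y" by simp
  then show ?thesis using assms(2) by metis
qed

text \<open>Between consecutive jumps the profile is constant, so the right end of one fan is the
  left value at the next jump and the fans join to one chain.\<close>

lemma fronts:
  assumes "0 < a" "step_function f" "\<And>x. admissible a n (f x)"
  shows "chain (entropic a n) (value_at_minus_infinity f) (fronts a n f)"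
    and "\<And>p. p \<in> set (fronts a n f) \<Longrightarrow> admissible a n (snd (snd p))"
    and "admissible a n (value_at_minus_infinity f)"
proof -
  define G where
    "G = (\<lambda>y. map (\<lambda>(\<sigma>, s). (y, \<sigma>, s)) (riemann_fan a n (left_value f y) (f y)))"
  have fronts: "fronts a n f = concat (map G (sorted_list_of_set (jumps f)))"
    by (simp add: fronts_def G_def)
  have G: "chain (entropic a n) (left_value f y) (G y)" "G y \<noteq> []" "snd (snd (last (G y))) = f y"
      "\<And>p. p \<in> set (G y) \<Longrightarrow> admissible a n (snd (snd p))" if "y \<in> jumps f" for y
    using riemann_fan[OF assms(1) admissible_left_value[OF assms(2,3)] assms(3), where y = y] that
    unfolding G_def jumps_def by blast+
  \<comment> \<open>Generalised to the jumps to the right of an arbitrary \<open>c\<close>, so that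
    the induction can restart from the jump just treated.\<close>
  have chain: "chain (entropic a n) (f c) (concat (map G ys))"
    if "sorted_wrt (<) ys" "set ys = jumps f \<inter> {c<..}" for ys c
    using that
  proof (induction ys arbitrary: c)
    case Nil
    then show ?case by simp
  next
    case (Cons y ys)
    have y: "y \<in> jumps f" "c < y" using Cons.prems by auto
    have less: "\<And>z. z \<in> set ys \<Longrightarrow> y < z" using Cons.prems(1) by auto
    have mem: "z \<in> jumps f \<Longrightarrow> c < z \<Longrightarrow> z = y \<or> z \<in> set ys" "z \<in> set ys \<Longrightarrow> z \<in> jumps f" for z
      using Cons.prems(2) by auto
    have between: "jumps f \<inter> {c<..<y} = {}"
      using mem(1) less by fastforce
    have ys: "set ys = jumps f \<inter> {y<..}"
      using mem less y(2) by fastforce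
    obtain x0 where x0: "x0 < y" "\<And>x. x0 < x \<Longrightarrow> x < y \<Longrightarrow> f x = left_value f y"
      using step_function_left_value[OF assms(2)] by blast
    define x where "x = (max c x0 + y) / 2"
    have x: "c < x" "x < y" "x0 < x"
      using y(2) x0(1) by (auto simp: x_def)
    have "f c = f x"
      using x between by (intro step_function_const[OF assms(2)]) auto
    then have "f c = left_value f y" using x0(2) x by simp
    then show ?case
      using G[OF y(1)] Cons.IH[OF _ ys] Cons.prems(1) by (auto simp: chain_append)
  qed
  obtain x0 where x0: "\<And>x. x \<le> x0 \<Longrightarrow> f x = value_at_minus_infinity f"
    using step_function_minus_infinity[OF assms(2)] by blast
  note fin = finite_jumps[OF assms(2)]
  \<comment> \<open>To the left of all jumps and within the range where \<open>f\<close> has its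
    value at minus infinity.\<close>
  define c where "c = min x0 (Min (insert 0 (jumps f)) - 1)"
  have "c < y" if "y \<in> jumps f" for y
  proof -
    have "Min (insert 0 (jumps f)) \<le> y" using fin that by (intro Min_le) auto
    then show ?thesis by (simp add: c_def)
  qed
  then have "jumps f \<inter> {c<..} = jumps f" by auto
  moreover have c: "f c = value_at_minus_infinity f"
    by (rule x0) (simp add: c_def)
  ultimately show "chain (entropic a n) (value_at_minus_infinity f) (fronts a n f)"
    using chain[of "sorted_list_of_set (jumps f)" c] fin
    by (simp add: fronts strict_sorted_list_of_set)
  show "admissible a n (value_at_minus_infinity f)" using c assms(3) by metis
  show "\<And>p. p \<in> set (fronts a n f) \<Longrightarrow> admissible a n (snd (snd p))"
    using G(4) fin by (auto simp: fronts)
qed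

lemma propagate_eq:
  assumes "sorted (map (front_position h) (fronts a n f))"
  shows "g (propagate a n f h x) = step_sum g (value_at_minus_infinity f) (fronts a n f) h x"
  using step_sum_eq[OF assms, of g] by (simp add: propagate_def Let_def)

lemma propagate_admissible:
  assumes "0 < a" "step_function f" "\<And>x. admissible a n (f x)"
  shows "step_function (propagate a n f h)" "admissible a n (propagate a n f h x)"
proof -
  let ?F = "fronts a n f"
  have "propagate a n f h x = propagate a n f h y"
    if "x \<le> y" "front_position h ` set ?F \<inter> {x<..y} = {}" for x y
  proof -
    have "filter (\<lambda>p. front_position h p \<le> x) ?F = filter (\<lambda>p. front_position h p \<le> y) ?F"
      using that by (intro filter_cong) force+
    then show ?thesis by (simp add: propagate_def)
  qed
  then show "step_function (propagate a n f h)"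
    unfolding step_function_def by (intro exI[of _ "front_position h ` set ?F"]) auto
  show "admissible a n (propagate a n f h x)"
  proof (cases "filter (\<lambda>p. front_position h p \<le> x) ?F = []")
    case True
    then show ?thesis using fronts(3)[OF assms] by (simp add: propagate_def)
  next
    case False
    from last_in_set[OF this] have "last (filter (\<lambda>p. front_position h p \<le> x) ?F) \<in> set ?F"
      by auto
    from fronts(2)[OF assms this] show ?thesis
      using False by (simp add: propagate_def Let_def)
  qed
qed

section \<open>The entropy inequality for front tracking\<close>

text \<open>Fixes the witnesses \<open>\<tau>\<close> and \<open>N\<close> hidden in
  \<open>front_tracking\<close> and adds admissibility of the initial profile.\<close>

locale tracked =
  fixes a T :: real and n :: nat and f :: "real \<Rightarrow> state" and U :: "real \<Rightarrow> real \<Rightarrow> state"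
    and \<tau> :: "nat \<Rightarrow> real" and N :: nat
  assumes a: "0 < a"
    and step_f: "step_function f" and admissible_f: "\<And>x. admissible a n (f x)"
    and U0: "U 0 = f" and \<tau>0: "\<tau> 0 = 0" and \<tau>N: "\<tau> N = T"
    and \<tau>_less: "\<And>i. i < N \<Longrightarrow> \<tau> i < \<tau> (Suc i)"
    and sorted: "\<And>i t. i < N \<Longrightarrow> t \<in> {\<tau> i..\<tau> (Suc i)} \<Longrightarrow>
      sorted (map (front_position (t - \<tau> i)) (fronts a n (U (\<tau> i))))"
    and U_eq: "\<And>i t. i < N \<Longrightarrow> t \<in> {\<tau> i..\<tau> (Suc i)} \<Longrightarrow>
      U t = propagate a n (U (\<tau> i)) (t - \<tau> i)"
begin

lemma profile:
  assumes "i \<le> N"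
  shows "step_function (U (\<tau> i)) \<and> (\<forall>x. admissible a n (U (\<tau> i) x))"
  using assms
proof (induction i)
  case 0
  then show ?case using step_f admissible_f by (simp add: \<tau>0 U0)
next
  case (Suc i)
  then have "step_function (U (\<tau> i))" "\<And>x. admissible a n (U (\<tau> i) x)" by auto
  note propagate_admissible[OF a this, of "\<tau> (Suc i) - \<tau> i"]
  moreover have "U (\<tau> (Suc i)) = propagate a n (U (\<tau> i)) (\<tau> (Suc i) - \<tau> i)"
    using Suc.prems \<tau>_less[of i] by (intro U_eq) auto
  ultimately show ?case by metis
qed

abbreviation "base i \<equiv> value_at_minus_infinity (U (\<tau> i))"
abbreviation "slab_fronts i \<equiv> fronts a n (U (\<tau> i))"

lemma U_step_sum:
  assumes "i < N" "t \<in> {\<tau> i..\<tau> (Suc i)}"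
  shows "g (U t x) = step_sum g (base i) (slab_fronts i) (t - \<tau> i) x"
  using propagate_eq[OF sorted[OF assms], of g x] U_eq[OF assms] by simp

lemma \<tau>_nonneg: "i \<le> N \<Longrightarrow> 0 \<le> \<tau> i"
proof (induction i)
  case (Suc i)
  then show ?case using \<tau>_less[of i] by simp
qed (simp add: \<tau>0)

lemma indicator_Suc:
  assumes "i < N"
  shows "(indicator {0..<\<tau> (Suc i)} t :: real) = indicator {0..<\<tau> i} t + indicator {\<tau> i..<\<tau> (Suc i)} t"
  using \<tau>_less[OF assms] \<tau>_nonneg[of i] assms by (auto simp: indicator_def)

lemma slab_eq:
  assumes "i < N"
  shows "indicator {\<tau> i..<\<tau> (Suc i)} (snd p) * g (U (snd p) (fst p)) =
    (indicator {\<tau> i..<\<tau> (Suc i)} (snd p) *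
      step_sum g (base i) (slab_fronts i) (snd p - \<tau> i) (fst p) :: real)"
  using U_step_sum[OF assms, of "snd p" g "fst p"] by (auto simp: indicator_def)

context
  fixes \<phi> \<phi>x \<phi>t :: "real \<times> real \<Rightarrow> real" and R :: real
  assumes test: "c1_test \<phi> \<phi>x \<phi>t R"
begin

interpretation c1_test \<phi> \<phi>x \<phi>t R by (rule test)

lemma integrable_slab:
  assumes "i < N"
  shows "integrable lborel (\<lambda>p. indicator {\<tau> i..<\<tau> (Suc i)} (snd p) * g (U (snd p) (fst p)) * \<phi>x p)"
    and "integrable lborel (\<lambda>p. indicator {\<tau> i..<\<tau> (Suc i)} (snd p) * g (U (snd p) (fst p)) * \<phi>t p)"
proof -
  obtain B where "\<And>h x. \<bar>step_sum g (base i) (slab_fronts i) h x\<bar> \<le> B"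
    using step_sum_bounded by blast
  then have le: "\<bar>indicator {\<tau> i..<\<tau> (Suc i)} (snd p) *
      step_sum g (base i) (slab_fronts i) (snd p - \<tau> i) (fst p)\<bar> \<le> max B 0" for p :: "real \<times> real"
    by (auto simp: indicator_def le_max_iff_disj)
  show "integrable lborel (\<lambda>p. indicator {\<tau> i..<\<tau> (Suc i)} (snd p) * g (U (snd p) (fst p)) * \<phi>x p)"
    and "integrable lborel (\<lambda>p. indicator {\<tau> i..<\<tau> (Suc i)} (snd p) * g (U (snd p) (fst p)) * \<phi>t p)"
    unfolding slab_eq[OF assms] by (rule integrable_test[OF _ le]; measurable)+
qed

lemma integrable_strip_aux:
  assumes "i \<le> N"
  shows "integrable lborel (\<lambda>p. indicator {0..<\<tau> i} (snd p) * g (U (snd p) (fst p)) * \<phi>x p) \<and>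
    integrable lborel (\<lambda>p. indicator {0..<\<tau> i} (snd p) * g (U (snd p) (fst p)) * \<phi>t p)"
  using assms
proof (induction i)
  case 0
  then show ?case by (simp add: \<tau>0)
next
  case (Suc i)
  then have "i < N" by simp
  note ind = indicator_Suc[OF this]
  show ?case
    using integrable_slab[OF \<open>i < N\<close>, of g] Suc
    unfolding ind distrib_right by auto
qed

lemma integrable_strip:
  shows "integrable lborel (\<lambda>p. indicator {0..<T} (snd p) * g (U (snd p) (fst p)) * \<phi>x p)"
    and "integrable lborel (\<lambda>p. indicator {0..<T} (snd p) * g (U (snd p) (fst p)) * \<phi>t p)"
  using integrable_strip_aux[of N g] by (auto simp: \<tau>N)

text \<open>\<open>entropy_slab\<close> is summed over the time slabs. \<open>U_step_sum\<close>
  holds at both endpoints of a slab, so adjacent slabs have the same boundary term \<open>E\<close>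
  and the sum telescopes.\<close>

lemma entropy_tracked:
  assumes "k \<in> grid n" "zh \<in> configs a" "compatible_state a (k, zh)"
  defines "q \<equiv> \<lambda>s :: state. \<bar>fst s - k\<bar>"
  defines "\<eta> \<equiv> \<lambda>s. q s + cdist a (snd s) zh"
  defines "E \<equiv> \<lambda>t. LBINT x. \<eta> (U t x) * \<phi> (x, t)"
  shows "E T - E 0 \<le> (LBINT p. indicator {0..<T} (snd p) * \<eta> (U (snd p) (fst p)) * \<phi>t p +
    indicator {0..<T} (snd p) * q (U (snd p) (fst p)) * \<phi>x p)"
proof -
  have "E (\<tau> i) - E 0 \<le> (LBINT p. indicator {0..<\<tau> i} (snd p) * \<eta> (U (snd p) (fst p)) * \<phi>t p +
    indicator {0..<\<tau> i} (snd p) * q (U (snd p) (fst p)) * \<phi>x p)" if "i \<le> N" for i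
    using that
  proof (induction i)
    case 0
    then show ?case by (simp add: \<tau>0)
  next
    case (Suc i)
    then have i: "i < N" by simp
    note less = \<tau>_less[OF i]
    let ?W = "\<lambda>p. indicator {\<tau> i..<\<tau> (Suc i)} (snd p) * \<eta> (U (snd p) (fst p)) * \<phi>t p +
      indicator {\<tau> i..<\<tau> (Suc i)} (snd p) * q (U (snd p) (fst p)) * \<phi>x p"
    have profile_i: "step_function (U (\<tau> i))" "\<And>x. admissible a n (U (\<tau> i) x)"
      using profile[of i] i by auto
    have "chain (entropic a n) (base i) (slab_fronts i)"
      by (rule fronts(1)[OF a profile_i])
    then have "chain (\<lambda>l \<sigma> r. \<sigma> * (\<eta> l - \<eta> r) \<le> q l - q r) (base i) (slab_fronts i)"
    proof (rule chain_mono)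
      fix l \<sigma> r assume "entropic a n l \<sigma> r"
      then show "\<sigma> * (\<eta> l - \<eta> r) \<le> q l - q r"
        using assms(1-3) by (auto simp: entropic_def \<eta>_def q_def)
    qed
    note slab = entropy_slab(2)[OF less_imp_le[OF less] this]
    have "(LBINT x. step_sum \<eta> (base i) (slab_fronts i) (t - \<tau> i) x * \<phi> (x, t)) = E t"
      if "t \<in> {\<tau> i..\<tau> (Suc i)}" for t
      unfolding E_def U_step_sum[OF i that, of \<eta>] ..
    note E = this[of "\<tau> i"] this[of "\<tau> (Suc i)"]
    have "E (\<tau> (Suc i)) - E (\<tau> i) \<le> integral\<^sup>L lborel ?W"
      unfolding slab_eq[OF i] using slab E less by (simp add: distrib_left mult.assoc)
    moreover have "(LBINT p. indicator {0..<\<tau> (Suc i)} (snd p) * \<eta> (U (snd p) (fst p)) * \<phi>t p +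
        indicator {0..<\<tau> (Suc i)} (snd p) * q (U (snd p) (fst p)) * \<phi>x p) =
      (LBINT p. (indicator {0..<\<tau> i} (snd p) * \<eta> (U (snd p) (fst p)) * \<phi>t p +
        indicator {0..<\<tau> i} (snd p) * q (U (snd p) (fst p)) * \<phi>x p) + ?W p)"
      unfolding indicator_Suc[OF i] by (simp add: algebra_simps)
    moreover have "\<dots> = (LBINT p. indicator {0..<\<tau> i} (snd p) * \<eta> (U (snd p) (fst p)) * \<phi>t p +
        indicator {0..<\<tau> i} (snd p) * q (U (snd p) (fst p)) * \<phi>x p) + integral\<^sup>L lborel ?W"
      using integrable_slab[OF i] integrable_strip_aux[of i] i
      by (intro Bochner_Integration.integral_add Bochner_Integration.integrable_add) auto
    ultimately show ?case using Suc by simp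
  qed
  from this[of N] show ?thesis by (simp add: \<tau>N)
qed

end
end

text \<open>At time zero the given derivatives are only one-sided. But the support \<open>K\<close>
  is a compact subset of the open half plane, so the open sets \<open>?H\<close> and
  \<open>- K\<close> cover the plane; on the first the extension is the original function, on the
  second it is zero.\<close>

lemma test_function_extension:
  assumes "test_function \<phi>"
  obtains \<phi>' \<phi>x \<phi>t R where "c1_test \<phi>' \<phi>x \<phi>t R"
    and "\<And>x t. t \<le> 0 \<Longrightarrow> \<phi>' (x, t) = 0" "\<And>x t. t \<le> 0 \<Longrightarrow> \<phi>x (x, t) = 0"
      "\<And>x t. t \<le> 0 \<Longrightarrow> \<phi>t (x, t) = 0"
    and "\<And>x t. 0 < t \<Longrightarrow> deriv (\<lambda>s. \<phi> (x, s)) t = \<phi>t (x, t)"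
      "\<And>x t. 0 < t \<Longrightarrow> deriv (\<lambda>y. \<phi> (y, t)) x = \<phi>x (x, t)"
proof -
  let ?S = "UNIV \<times> {0..} :: (real \<times> real) set"
  let ?H = "UNIV \<times> {0<..} :: (real \<times> real) set"
  define K where "K = closure {p \<in> ?S. \<phi> p \<noteq> 0}"
  obtain D where D: "D 0 0 = \<phi>" "\<And>i j p. p \<in> ?S \<Longrightarrow> (D i j has_derivative
        (\<lambda>h. fst h * D (Suc i) j p + snd h * D i (Suc j) p)) (at p within ?S)"
    using assms unfolding test_function_def smooth_on_def by blast
  have K: "compact K" "K \<subseteq> ?H" and nonneg: "\<And>p. p \<in> ?S \<Longrightarrow> 0 \<le> \<phi> p"
    using assms by (auto simp: test_function_def K_def)
  have open_H: "open ?H" by (intro open_Times) auto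
  \<comment> \<open>In the open half plane the derivative within \<open>?S\<close> is a derivative
    in the full sense.\<close>
  have at_H: "at p within ?S = at p" if "p \<in> ?H" for p
    by (rule at_within_open_subset[OF that open_H]) (auto simp: less_imp_le)
  have open_K: "open (- K)" using K(1) compact_imp_closed by blast
  have cover: "?H \<union> - K = UNIV" using K(2) by blast
  define ext where "ext = (\<lambda>g p. if p \<in> ?H then g p else 0 :: real)"
  have deriv_H: "(ext (D i j) has_derivative
      (\<lambda>h. fst h * D (Suc i) j p + snd h * D i (Suc j) p)) (at p)" if "p \<in> ?H" for i j p
  proof (rule has_derivative_transform_within_open[OF _ open_H that])
    show "(D i j has_derivative (\<lambda>h. fst h * D (Suc i) j p + snd h * D i (Suc j) p)) (at p)"
      using D(2)[of p i j] that at_H[OF that] by auto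
  qed (simp add: ext_def)
  have zero: "ext \<phi> p = 0" if "p \<in> - K" for p
  proof -
    have "p \<notin> {p \<in> ?S. \<phi> p \<noteq> 0}"
      using that closure_subset[of "{p \<in> ?S. \<phi> p \<noteq> 0}"] unfolding K_def by (meson ComplD subsetD)
    then show ?thesis by (cases p) (auto simp: ext_def)
  qed
  have deriv_0: "(ext \<phi> has_derivative (\<lambda>h. 0)) (at p)" if "p \<in> - K" for p
    by (rule has_derivative_transform_within_open[OF _ open_K that, of "\<lambda>_. 0"]) (auto simp: zero)
  have zero_D: "ext (D 1 0) p = 0 \<and> ext (D 0 1) p = 0" if "p \<in> - K" for p
  proof (cases "p \<in> ?H")
    case True
    have "(ext \<phi> has_derivative (\<lambda>h. fst h * D 1 0 p + snd h * D 0 1 p)) (at p)"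
      using deriv_H[OF True, of 0 0] D(1) by simp
    then have eq: "(\<lambda>h. fst h * D 1 0 p + snd h * D 0 1 p) = (\<lambda>h. 0)"
      using deriv_0[OF that] has_derivative_unique by blast
    show ?thesis
      using fun_cong[OF eq, of "(1, 0)"] fun_cong[OF eq, of "(0, 1)"] by (simp add: ext_def)
  qed (simp add: ext_def)
  \<comment> \<open>Continuity is glued from the two sets of the open cover; on \<open>?H\<close> it
    comes from differentiability, the next order of \<open>D\<close> being available.\<close>
  have cont: "continuous_on UNIV (ext (D i j))" if "\<And>p. p \<in> - K \<Longrightarrow> ext (D i j) p = 0" for i j
  proof -
    have "continuous_on ?H (ext (D i j))"
      using deriv_H[of _ i j] has_derivative_continuous
      by (blast intro: continuous_at_imp_continuous_on)
    moreover have "continuous_on (- K) (ext (D i j))"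
      using continuous_on_const[of "- K" "0 :: real"] by (rule continuous_on_eq) (simp add: that)
    ultimately show ?thesis
      using continuous_on_open_Un[OF open_H open_K] cover by metis
  qed
  obtain R where R: "\<And>p. p \<in> K \<Longrightarrow> norm p \<le> R"
    using compact_imp_bounded[OF K(1)] by (auto simp: bounded_iff)
  have test: "c1_test (ext \<phi>) (ext (D 1 0)) (ext (D 0 1)) R"
  proof
    fix p
    show "(ext \<phi> has_derivative (\<lambda>h. fst h * ext (D 1 0) p + snd h * ext (D 0 1) p)) (at p)"
    proof (cases "p \<in> ?H")
      case True
      then have "ext (D 1 0) p = D 1 0 p" "ext (D 0 1) p = D 0 1 p"
        by (simp_all add: ext_def)
      then show ?thesis using deriv_H[OF True, of 0 0] D(1) by simp
    next
      case False
      then have "p \<in> - K" using K(2) by blast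
      then show ?thesis using deriv_0 zero_D by simp
    qed
    show "0 \<le> ext \<phi> p" using nonneg by (auto simp: ext_def)
  next
    fix x t assume "R < \<bar>x\<bar> \<or> R < \<bar>t\<bar>"
    then have "R < norm (x, t)"
      using norm_fst_le[of x t] norm_snd_le[of t x] by auto
    then have "(x, t) \<in> - K" using R[of "(x, t)"] by auto
    then show "ext \<phi> (x, t) = 0" by (rule zero)
  qed (use cont zero_D in auto)
  interpret c1_test "ext \<phi>" "ext (D 1 0)" "ext (D 0 1)" R by (rule test)
  show thesis
  proof
    show "c1_test (ext \<phi>) (ext (D 1 0)) (ext (D 0 1)) R" by (rule test)
    show "ext \<phi> (x, t) = 0" "ext (D 1 0) (x, t) = 0" "ext (D 0 1) (x, t) = 0" if "t \<le> 0" for x t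
      using that by (auto simp: ext_def)
    fix x t :: real assume t: "0 < t"
    have "((\<lambda>s. ext \<phi> (x, s)) has_real_derivative ext (D 0 1) (x, t)) (at t)"
      using has_real_derivative_line[of x 0 0 t] by simp
    then have "((\<lambda>s. \<phi> (x, s)) has_real_derivative ext (D 0 1) (x, t)) (at t)"
      by (rule has_field_derivative_transform_within_open[of _ _ _ "{0<..}"]) (auto simp: ext_def t)
    then show "deriv (\<lambda>s. \<phi> (x, s)) t = ext (D 0 1) (x, t)"
      by (rule DERIV_imp_deriv)
    have "(\<lambda>y. ext \<phi> (y, t)) = (\<lambda>y. \<phi> (y, t))"
      using t by (simp add: ext_def)
    then show "deriv (\<lambda>y. \<phi> (y, t)) x = ext (D 1 0) (x, t)"
      using has_real_derivative_fst[of t x] DERIV_imp_deriv by metis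
  qed
qed

section \<open>Passage to the limit\<close>

lemma integral_tendsto_of_bound:
  fixes h :: "'a \<Rightarrow> real"
  assumes h: "\<And>i. integrable M (h' i)" "integrable M h" and "0 < C"
    and bound: "\<And>i. AE p in M. \<bar>h' i p - h p\<bar> \<le> C * e i p"
    and lim: "(\<lambda>i. \<integral>\<^sup>+p. ennreal (e i p) \<partial>M) \<longlonglongrightarrow> 0"
  shows "(\<lambda>i. integral\<^sup>L M (h' i)) \<longlonglongrightarrow> integral\<^sup>L M h"
proof (rule tendsto_L1_int[OF h])
  note [measurable] = h[THEN borel_measurable_integrable]
  have le: "(\<integral>\<^sup>+p. ennreal (norm (h' i p - h p)) \<partial>M) \<le> ennreal C * (\<integral>\<^sup>+p. ennreal (e i p) \<partial>M)" for i
  proof -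
    \<comment> \<open>\<open>e\<close> need not be measurable, so the constant is moved to the other side.\<close>
    have "(\<integral>\<^sup>+p. ennreal (norm (h' i p - h p)) \<partial>M) =
        (\<integral>\<^sup>+p. ennreal C * ennreal (\<bar>h' i p - h p\<bar> / C) \<partial>M)"
      using assms(3) by (simp flip: ennreal_mult)
    also have "\<dots> = ennreal C * (\<integral>\<^sup>+p. ennreal (\<bar>h' i p - h p\<bar> / C) \<partial>M)"
      by (rule nn_integral_cmult) measurable
    also have "(\<integral>\<^sup>+p. ennreal (\<bar>h' i p - h p\<bar> / C) \<partial>M) \<le> (\<integral>\<^sup>+p. ennreal (e i p) \<partial>M)"
    proof (rule nn_integral_mono_AE)
      show "AE p in M. ennreal (\<bar>h' i p - h p\<bar> / C) \<le> ennreal (e i p)"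
        using bound[of i] by eventually_elim (use assms(3) in \<open>auto intro!: ennreal_leI simp: field_simps\<close>)
    qed
    finally show ?thesis by (simp add: mult_left_mono)
  qed
  have "(\<lambda>i. ennreal C * (\<integral>\<^sup>+p. ennreal (e i p) \<partial>M)) \<longlonglongrightarrow> ennreal C * 0"
    by (intro ennreal_tendsto_cmult lim) simp
  then have "(\<lambda>i. ennreal C * (\<integral>\<^sup>+p. ennreal (e i p) \<partial>M)) \<longlonglongrightarrow> 0"
    by simp
  then show "(\<lambda>i. \<integral>\<^sup>+p. ennreal (norm (h' i p - h p)) \<partial>M) \<longlonglongrightarrow> 0"
    by (rule tendsto_sandwich[OF always_eventually always_eventually tendsto_const, rotated 2])
      (use le in simp_all)
qed

text \<open>Rounding down keeps relays at \<open>-1\<close> compatible, so only relays at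
  \<open>1\<close> with lower threshold at least \<open>kn n\<close> have to be switched. Those have
  lower threshold below \<open>k\<close>, so each fixed relay is switched for finitely many
  \<open>n\<close> only, and dominated convergence gives the limit.\<close>

lemma grid_approximation:
  assumes "0 < a" "zh \<in> configs a"
    and zh: "\<And>\<rho>. \<rho> \<in> preisach_triangle a \<inter> half_plane \<Longrightarrow> (k, zh \<rho>) \<in> relay_domain \<rho>"
  obtains kn zn where "\<And>n. kn n \<in> grid n" "\<And>n. zn n \<in> configs a"
    and "\<And>n. compatible_state a (kn n, zn n)"
    and "kn \<longlonglongrightarrow> k" "(\<lambda>n. cdist a (zn n) zh) \<longlonglongrightarrow> 0"
proof -
  let ?M = "lebesgue_on (preisach_triangle a)"
  define kn where "kn = (\<lambda>n. of_int \<lfloor>k * 2 ^ n\<rfloor> / 2 ^ n :: real)"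
  define zn where "zn = (\<lambda>n. \<lambda>\<rho>\<in>half_plane. if kn n \<le> fst \<rho> then -1 else zh \<rho>)"
  have kn_le: "kn n \<le> k" and kn_ge: "k - 1 / 2 ^ n \<le> kn n" for n
  proof -
    show "kn n \<le> k" by (simp add: kn_def field_simps)
    have "k * 2 ^ n - 1 \<le> of_int \<lfloor>k * 2 ^ n\<rfloor>" by linarith
    then have "(k * 2 ^ n - 1) / 2 ^ n \<le> kn n"
      unfolding kn_def by (intro divide_right_mono) auto
    then show "k - 1 / 2 ^ n \<le> kn n" by (simp add: diff_divide_distrib)
  qed
  have pm: "zh \<rho> = -1 \<or> zh \<rho> = 1" if "\<rho> \<in> half_plane" for \<rho>
    using assms(2) that by (auto simp: configs_def)
  have "(\<lambda>n. k - (1 / 2) ^ n) \<longlonglongrightarrow> k - 0"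
    by (intro tendsto_intros LIMSEQ_power_zero) simp
  then have "(\<lambda>n. k - (1 / 2) ^ n) \<longlonglongrightarrow> k" by simp
  then have kn_lim: "kn \<longlonglongrightarrow> k"
  proof (rule tendsto_sandwich[OF _ _ _ tendsto_const, rotated 2]; intro always_eventually)
    show "\<forall>n. k - (1 / 2) ^ n \<le> kn n" using kn_ge by (simp add: power_one_over)
    show "\<forall>n. kn n \<le> k" using kn_le by simp
  qed
  have zn_configs: "zn n \<in> configs a" for n
  proof -
    have [measurable]: "zh \<in> borel_measurable ?M" "fst \<in> borel_measurable ?M" "snd \<in> borel_measurable ?M"
      using assms(2) by (auto simp: configs_def intro!: borel_measurable_lebesgue_on_borel)
    have "Measurable.pred ?M (\<lambda>\<rho>. fst \<rho> < snd \<rho>)"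
      by measurable
    then have [measurable]: "Measurable.pred ?M (\<lambda>\<rho>. \<rho> \<in> half_plane)"
      by (simp add: half_plane_def)
    have "zn n \<in> borel_measurable ?M"
      unfolding zn_def restrict_def by measurable
    then show ?thesis
      using pm by (auto simp: configs_def zn_def)
  qed
  have AE_relay: "AE \<rho> in ?M. \<rho> \<in> half_plane \<and> (k, zh \<rho>) \<in> relay_domain \<rho>"
    using AE_half_plane[OF assms(1)] AE_space[of ?M] by eventually_elim (use zh in auto)
  have zn_compat: "compatible_state a (kn n, zn n)" for n
    unfolding compatible_state_def using AE_relay
    by eventually_elim
      (use kn_le[of n] in \<open>auto simp: zn_def relay_domain_def half_plane_def\<close>)
  have "(\<lambda>n. LINT \<rho>|?M. \<bar>zn n \<rho> - zh \<rho>\<bar>) \<longlonglongrightarrow> (LINT \<rho>|?M. 0)"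
  proof (rule integral_dominated_convergence[where w = "\<lambda>_. 2"])
    show "(\<lambda>\<rho>. \<bar>zn n \<rho> - zh \<rho>\<bar>) \<in> borel_measurable ?M" for n
      using integrable_configs_diff(1)[OF assms(1) zn_configs assms(2)] by simp
    show "integrable ?M (\<lambda>_. 2 :: real)"
      using finite_measure_triangle finite_measure.integrable_const by blast
    show "AE \<rho> in ?M. norm \<bar>zn n \<rho> - zh \<rho>\<bar> \<le> 2" for n
      using AE_configs[OF assms(1) zn_configs[of n]] AE_configs[OF assms(1,2)] by eventually_elim auto
    show "AE \<rho> in ?M. (\<lambda>n. \<bar>zn n \<rho> - zh \<rho>\<bar>) \<longlonglongrightarrow> 0"
      using AE_relay
    proof eventually_elim
      case (elim \<rho>)
      \<comment> \<open>A relay at \<open>-1\<close> is never changed. A relay at \<open>1\<close>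
        has its lower threshold strictly below \<open>k\<close>, hence eventually below
        \<open>kn n\<close>.\<close>
      have "\<forall>\<^sub>F n in sequentially. zn n \<rho> = zh \<rho>"
      proof (cases "zh \<rho> = -1")
        case True
        then show ?thesis using elim by (simp add: zn_def)
      next
        case False
        then have "fst \<rho> < k"
          using elim by (auto simp: relay_domain_def)
        from order_tendstoD(1)[OF kn_lim this] show ?thesis
          by eventually_elim (use elim in \<open>auto simp: zn_def\<close>)
      qed
      then show ?case
        by (intro tendsto_eventually) (auto elim: eventually_mono)
    qed
  qed simp
  then have "(\<lambda>n. cdist a (zn n) zh) \<longlonglongrightarrow> 0"
    by (simp add: cdist_eq)
  moreover have "kn n \<in> grid n" for n
    by (auto simp: kn_def grid_def)
  ultimately show thesis
    using that[of kn zn] zn_configs zn_compat kn_lim by blast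
qed

text \<open>Compatibility of the data is given for almost every \<open>x\<close>. A right-continuous
  step function keeps its value on an interval to the right of \<open>x\<close>, which is not a null
  set, so compatibility holds at every \<open>x\<close>.\<close>

lemma admissible_initial:
  assumes "0 < a" "approximate_data a T L u0 z0 v \<zeta>"
  shows "step_function (\<lambda>x. (v n x, \<zeta> n x))" "admissible a n (v n x, \<zeta> n x)"
proof -
  have v: "step_function (v n)" "range (v n) \<subseteq> grid n"
    and \<zeta>: "step_function (\<zeta> n)" "range (\<zeta> n) \<subseteq> grid_states a T L n"
    and compatible: "compatible a (v n) (\<zeta> n)"
    using assms(2) by (auto simp: approximate_data_def)
  obtain D D' where D: "finite D" "\<And>x y. x \<le> y \<Longrightarrow> D \<inter> {x<..y} = {} \<Longrightarrow> v n x = v n y"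
    and D': "finite D'" "\<And>x y. x \<le> y \<Longrightarrow> D' \<inter> {x<..y} = {} \<Longrightarrow> \<zeta> n x = \<zeta> n y"
    using v(1) \<zeta>(1) unfolding step_function_def by meson
  have fin: "finite (D \<union> D')" using D(1) D'(1) by simp
  have const: "(v n x, \<zeta> n x) = (v n y, \<zeta> n y)" if "x \<le> y" "(D \<union> D') \<inter> {x<..y} = {}" for x y
    using D(2)[OF that(1)] D'(2)[OF that(1)] that(2) by (simp add: Int_Un_distrib2)
  show "step_function (\<lambda>x. (v n x, \<zeta> n x))"
    unfolding step_function_def using fin const by blast
  \<comment> \<open>The next possible discontinuity to the right of \<open>x\<close>, or
    \<open>x + 1\<close> if that comes first.\<close>
  define b where "b = Min (insert (x + 1) ((D \<union> D') \<inter> {x<..}))"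
  have b: "x < b" "\<And>d. d \<in> D \<union> D' \<Longrightarrow> x < d \<Longrightarrow> b \<le> d"
    unfolding b_def using fin by auto
  have "AE y in lebesgue. compatible_state a (v n y, \<zeta> n y)"
    using compatible by (simp add: compatible_def compatible_state_def)
  then obtain N where N: "{y. \<not> compatible_state a (v n y, \<zeta> n y)} \<subseteq> N" "N \<in> null_sets lebesgue"
    by (auto elim!: AE_E simp: null_sets_def)
  have "\<not> {x<..<b} \<subseteq> N"
  proof
    assume "{x<..<b} \<subseteq> N"
    moreover have "negligible N" using N(2) by (simp add: negligible_iff_null_sets)
    ultimately have "negligible {x<..<b}" using negligible_subset by blast
    then show False using b(1) open_not_negligible[of "{x<..<b}"] by auto
  qed
  then obtain y where y: "x < y" "y < b" "compatible_state a (v n y, \<zeta> n y)"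
    using N(1) by (metis (mono_tags, lifting) greaterThanLessThan_iff mem_Collect_eq subset_eq)
  have "(v n x, \<zeta> n x) = (v n y, \<zeta> n y)"
    using y b(2) by (intro const) force+
  then have "compatible_state a (v n x, \<zeta> n x)" using y(3) by simp
  moreover have "\<zeta> n x \<in> grid_states a T L n" using \<zeta>(2) by auto
  then have "\<zeta> n x \<in> configs a"
    using lip_states_subset_configs by (auto simp: grid_states_def)
  moreover have "v n x \<in> grid n" using v(2) by auto
  ultimately show "admissible a n (v n x, \<zeta> n x)"
    by (simp add: admissible_def)
qed

context c1_test
begin

lemma bounded_deriv:
  obtains C where "0 < C" "\<And>p. \<bar>\<phi>x p\<bar> \<le> C" "\<And>p. \<bar>\<phi>t p\<bar> \<le> C"
proof -
  have *: "\<exists>C. \<forall>p. \<bar>\<psi> p\<bar> \<le> C"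
    if \<psi>: "continuous_on UNIV \<psi>" "\<And>x t. R < \<bar>x\<bar> \<or> R < \<bar>t\<bar> \<Longrightarrow> \<psi> (x, t) = 0"
    for \<psi> :: "real \<times> real \<Rightarrow> real"
  proof -
    let ?S = "cbox (-R, -R) (R, R)"
    have "compact (\<psi> ` ?S)"
      by (intro compact_continuous_image continuous_on_subset[OF \<psi>(1)]) auto
    then obtain C where C: "\<And>p. p \<in> ?S \<Longrightarrow> \<bar>\<psi> p\<bar> \<le> C"
      using compact_imp_bounded by (force simp: bounded_iff)
    have "\<bar>\<psi> (x, t)\<bar> \<le> max C 0" for x t
    proof (cases "R < \<bar>x\<bar> \<or> R < \<bar>t\<bar>")
      case True
      then show ?thesis using \<psi>(2)[of x t] by simp
    next
      case False
      then have "(x, t) \<in> ?S" by (auto simp: cbox_Pair_eq)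
      then show ?thesis using C[of "(x, t)"] by simp
    qed
    then show ?thesis by auto
  qed
  obtain C C' where "\<And>p. \<bar>\<phi>x p\<bar> \<le> C" "\<And>p. \<bar>\<phi>t p\<bar> \<le> C'"
    using *[OF continuous_\<phi>x support_deriv(1)] *[OF continuous_\<phi>t support_deriv(2)] by blast
  then show thesis
    using that[of "max 1 (max C C')"] by (simp add: le_max_iff_disj)
qed

lemma integrable_deriv_on:
  assumes "S \<in> sets lebesgue"
  shows "integrable (lebesgue_on S) \<phi>x" "integrable (lebesgue_on S) \<phi>t"
proof -
  have "integrable lebesgue \<phi>x" "integrable lebesgue \<phi>t"
    using integrable_test[of "\<lambda>_. 1" 1] by (simp_all add: integrable_completion)
  from this[THEN integrable_mult_indicator[OF assms]]
  show "integrable (lebesgue_on S) \<phi>x" "integrable (lebesgue_on S) \<phi>t"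
    using assms by (simp_all add: integrable_restrict_space)
qed

end

lemma strip_sets [simp]: "strip T \<in> sets lebesgue"
proof -
  have "open (strip T)" unfolding strip_def by (intro open_Times) auto
  then show ?thesis by auto
qed

context tracked
begin

text \<open>Locates the slab that contains \<open>t\<close>. It puts the configurations of the
  approximate solution into \<open>configs a\<close> on the whole strip, as the triangle inequality
  for \<open>cdist\<close> requires.\<close>

lemma admissible_U:
  assumes "0 \<le> t" "t < T"
  shows "admissible a n (U t x)"
proof -
  have "t < \<tau> j \<Longrightarrow> j \<le> N \<Longrightarrow> \<exists>i<N. \<tau> i \<le> t \<and> t < \<tau> (Suc i)" for j
  proof (induction j)
    case 0
    then show ?case using assms(1) \<tau>0 by simp
  next
    case (Suc j)
    show ?case
    proof (cases "t < \<tau> j")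
      case True
      then show ?thesis using Suc by simp
    next
      case False
      then show ?thesis using Suc.prems by (intro exI[of _ j]) auto
    qed
  qed
  from this[of N] obtain i where i: "i < N" "\<tau> i \<le> t" "t < \<tau> (Suc i)"
    using assms(2) \<tau>N by auto
  then have "step_function (U (\<tau> i))" "\<And>x. admissible a n (U (\<tau> i) x)"
    using profile[of i] by auto
  note propagate_admissible(2)[OF a this, of "t - \<tau> i" x]
  then show ?thesis using U_eq[OF i(1), of t] i by simp
qed

context
  fixes \<phi> \<phi>x \<phi>t :: "real \<times> real \<Rightarrow> real" and R :: real
  assumes test: "c1_test \<phi> \<phi>x \<phi>t R"
    and vanish: "\<And>x t. t \<le> 0 \<Longrightarrow> \<phi> (x, t) = 0" "\<And>x t. t \<le> 0 \<Longrightarrow> \<phi>x (x, t) = 0"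
      "\<And>x t. t \<le> 0 \<Longrightarrow> \<phi>t (x, t) = 0"
begin

text \<open>The strip omits time zero, which the slabs contain; the integrands still agree
  pointwise, because both derivatives vanish there.\<close>

lemma integral_on_strip:
  shows "integrable (lebesgue_on (strip T))
      (\<lambda>p. g (U (snd p) (fst p)) * \<phi>t p + g' (U (snd p) (fst p)) * \<phi>x p)"
    and "(LINT p|lebesgue_on (strip T). g (U (snd p) (fst p)) * \<phi>t p + g' (U (snd p) (fst p)) * \<phi>x p) =
      (LBINT p. indicator {0..<T} (snd p) * g (U (snd p) (fst p)) * \<phi>t p +
        indicator {0..<T} (snd p) * g' (U (snd p) (fst p)) * \<phi>x p)"
proof -
  let ?W = "\<lambda>p. indicator {0..<T} (snd p) * g (U (snd p) (fst p)) * \<phi>t p +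
    indicator {0..<T} (snd p) * g' (U (snd p) (fst p)) * \<phi>x p"
  have int: "integrable lborel ?W"
    using integrable_strip[OF test] by (intro Bochner_Integration.integrable_add) auto
  have eq: "indicator (strip T) p *\<^sub>R (g (U (snd p) (fst p)) * \<phi>t p + g' (U (snd p) (fst p)) * \<phi>x p) = ?W p" for p
    using vanish(2,3)[of "snd p" "fst p"] by (cases p) (auto simp: strip_def indicator_def)
  show "integrable (lebesgue_on (strip T))
      (\<lambda>p. g (U (snd p) (fst p)) * \<phi>t p + g' (U (snd p) (fst p)) * \<phi>x p)"
    using int by (simp only: integrable_restrict_space strip_sets sets.Int_space_eq2 eq)
      (simp add: integrable_completion borel_measurable_integrable)
  show "(LINT p|lebesgue_on (strip T). g (U (snd p) (fst p)) * \<phi>t p + g' (U (snd p) (fst p)) * \<phi>x p) =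
      integral\<^sup>L lborel ?W"
    by (simp only: integral_restrict_space strip_sets sets.Int_space_eq2 eq)
      (rule integral_completion[OF borel_measurable_integrable[OF int]])
qed

lemma entropy_tracked_nonneg:
  assumes "k \<in> grid n" "zh \<in> configs a" "compatible_state a (k, zh)"
  shows "0 \<le> (LINT p|lebesgue_on (strip T).
    (\<bar>fst (U (snd p) (fst p)) - k\<bar> + cdist a (snd (U (snd p) (fst p))) zh) * \<phi>t p +
    \<bar>fst (U (snd p) (fst p)) - k\<bar> * \<phi>x p)"
proof -
  interpret c1_test \<phi> \<phi>x \<phi>t R by (rule test)
  let ?E = "\<lambda>t. LBINT x. (\<bar>fst (U t x) - k\<bar> + cdist a (snd (U t x)) zh) * \<phi> (x, t)"
  \<comment> \<open>The test function vanishes at time zero but possibly not at time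
    \<open>T\<close>, so of the second boundary term only the sign is known.\<close>
  have "?E 0 = 0" by (simp add: vanish)
  moreover have "0 \<le> ?E T"
    by (intro integral_nonneg_AE AE_I2 mult_nonneg_nonneg add_nonneg_nonneg cdist_nonneg nonneg) auto
  ultimately show ?thesis
    using entropy_tracked[OF test assms]
    unfolding integral_on_strip(2)[of "\<lambda>s. \<bar>fst s - k\<bar> + cdist a (snd s) zh" "\<lambda>s. \<bar>fst s - k\<bar>"]
    by linarith
qed

end
end

lemma front_tracking_tracked:
  assumes "0 < a" "step_function f" "\<And>x. admissible a n (f x)" "front_tracking a T n f U"
  shows "\<exists>\<tau> N. tracked a T n f U \<tau> N"
proof -
  obtain \<tau> N where "U 0 = f" "\<tau> 0 = 0" "\<tau> N = T" and
    "\<forall>i<N. \<tau> i < \<tau> (Suc i) \<and> (\<forall>t\<in>{\<tau> i..\<tau> (Suc i)}.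
       sorted (map (front_position (t - \<tau> i)) (fronts a n (U (\<tau> i)))) \<and>
       U t = propagate a n (U (\<tau> i)) (t - \<tau> i))"
    using assms(4) unfolding front_tracking_def by blast
  then have "tracked a T n f U \<tau> N"
    using assms(1-3) by unfold_locales blast+
  then show ?thesis by blast
qed

theorem theorem6p3:
  fixes a T L :: real
    and u0 :: "real \<Rightarrow> real" and z0 :: "real \<Rightarrow> config"
    and u w :: "real \<Rightarrow> real \<Rightarrow> real" and z :: "real \<Rightarrow> real \<Rightarrow> config"
  assumes "a > 0" and "T > 0" and "L > 0"
    and "integrable lebesgue u0" and "Var dist UNIV u0 < \<infinity>"
    and "z0 \<in> L1_lip a T L" and "Var (cdist a) (lip_states T L) z0 < \<infinity>"
    and "\<And>x. polygonal_graph a UNIV (z0 x)"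
    and "compatible a u0 z0"
    and "constructed_solution a T L u0 z0 u z w"
  shows "entropy_solution a T u z"
  unfolding entropy_solution_def
proof (intro allI impI)
  fix \<phi> k zh
  assume "test_function \<phi> \<and> zh \<in> states T \<and>
    (\<forall>\<rho> \<in> preisach_triangle a \<inter> half_plane. (k, zh \<rho>) \<in> relay_domain \<rho>)"
  then have test: "test_function \<phi>" and zh: "zh \<in> configs a"
    and relay: "\<And>\<rho>. \<rho> \<in> preisach_triangle a \<inter> half_plane \<Longrightarrow> (k, zh \<rho>) \<in> relay_domain \<rho>"
    using states_subset_configs by auto
  let ?M = "lebesgue_on (strip T)"
  from assms(10) obtain v \<zeta> U r where
      u_int: "set_integrable lebesgue (strip T) (\<lambda>(x, t). u x t)"
    and z_configs: "AE (x, t) in ?M. z x t \<in> configs a"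
    and z_meas: "config_measurable a ?M (\<lambda>(x, t). z x t)"
    and data: "approximate_data a T L u0 z0 v \<zeta>"
    and U: "\<And>n. front_tracking a T n (\<lambda>x. (v n x, \<zeta> n x)) (U n)"
    and r: "strict_mono (r :: nat \<Rightarrow> nat)"
    and U_lim: "(\<lambda>i. \<integral>\<^sup>+(x, t)\<in>strip T. ennreal \<bar>fst (U (r i) t x) - u x t\<bar> \<partial>lebesgue) \<longlonglongrightarrow> 0"
      "(\<lambda>i. \<integral>\<^sup>+(x, t)\<in>strip T. ennreal (cdist a (snd (U (r i) t x)) (z x t)) \<partial>lebesgue) \<longlonglongrightarrow> 0"
    unfolding constructed_solution_def by blast
  have "\<exists>\<tau> N. tracked a T n (\<lambda>x. (v n x, \<zeta> n x)) (U n) \<tau> N" for n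
    by (rule front_tracking_tracked[OF assms(1) admissible_initial[OF assms(1) data] U])
  then obtain \<tau> N where tracked: "\<And>n. tracked a T n (\<lambda>x. (v n x, \<zeta> n x)) (U n) (\<tau> n) (N n)"
    by metis
  obtain \<psi> \<psi>x \<psi>t R where c1: "c1_test \<psi> \<psi>x \<psi>t R"
    and vanish: "\<And>x t. t \<le> 0 \<Longrightarrow> \<psi> (x, t) = 0" "\<And>x t. t \<le> 0 \<Longrightarrow> \<psi>x (x, t) = 0"
      "\<And>x t. t \<le> 0 \<Longrightarrow> \<psi>t (x, t) = 0"
    and deriv: "\<And>x t. 0 < t \<Longrightarrow> deriv (\<lambda>s. \<phi> (x, s)) t = \<psi>t (x, t)"
      "\<And>x t. 0 < t \<Longrightarrow> deriv (\<lambda>y. \<phi> (y, t)) x = \<psi>x (x, t)"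
    by (rule test_function_extension[OF test]) blast
  interpret c1_test \<psi> \<psi>x \<psi>t R by (rule c1)
  obtain C where C: "0 < C" "\<And>p. \<bar>\<psi>x p\<bar> \<le> C" "\<And>p. \<bar>\<psi>t p\<bar> \<le> C"
    using bounded_deriv by blast
  note \<psi>_int = integrable_deriv_on[OF strip_sets]
  note [measurable] = \<psi>_int[THEN borel_measurable_integrable]
  obtain kn zn where kn: "\<And>n. kn n \<in> grid n" and zn: "\<And>n. zn n \<in> configs a"
    and kn_zn: "\<And>n. compatible_state a (kn n, zn n)"
    and kn_lim: "kn \<longlonglongrightarrow> k" and zn_lim: "(\<lambda>n. cdist a (zn n) zh) \<longlonglongrightarrow> 0"
    using grid_approximation[OF assms(1) zh relay] by blast

  define ui where "ui = (\<lambda>n p. fst (U n (snd p) (fst p)))"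
  define zi where "zi = (\<lambda>n p. snd (U n (snd p) (fst p)))"
  define uu where "uu = (\<lambda>p. u (fst p) (snd p))"
  define zz where "zz = (\<lambda>p. z (fst p) (snd p))"
  have space_M: "space ?M = strip T" by simp
  have zi: "zi n p \<in> configs a" if "p \<in> strip T" for n p
    using tracked.admissible_U[OF tracked, of "snd p" n "fst p"] that
    by (auto simp: admissible_def zi_def strip_def)
  have zz: "AE p in ?M. zz p \<in> configs a"
    using z_configs by (simp add: zz_def split_def)
  have uu_int: "integrable ?M uu"
    using u_int by (simp add: set_integrable_def integrable_restrict_space uu_def split_def)
  have zz_meas: "(\<lambda>p. cdist a (zz p) zh) \<in> borel_measurable ?M"
    using z_meas zh by (simp add: config_measurable_def zz_def split_def)
  have ui_lim: "(\<lambda>i. \<integral>\<^sup>+p. ennreal \<bar>ui (r i) p - uu p\<bar> \<partial>?M) \<longlonglongrightarrow> 0"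
    and zi_lim: "(\<lambda>i. \<integral>\<^sup>+p. ennreal (cdist a (zi (r i) p) (zz p)) \<partial>?M) \<longlonglongrightarrow> 0"
    using U_lim by (simp_all add: nn_integral_restrict_space ui_def uu_def zi_def zz_def split_def)

  \<comment> \<open>\<open>A\<close> carries the part depending on \<open>u\<close>,
    \<open>B\<close> the memory part, so that the two convergence statements can be used
    separately.\<close>
  define A where "A = (\<lambda>k' n p. \<bar>ui n p - k'\<bar> * \<psi>t p + \<bar>ui n p - k'\<bar> * \<psi>x p)"
  define B where "B = (\<lambda>z' n p. cdist a (zi n p) z' * \<psi>t p)"
  have A_int: "integrable ?M (A k' n)" for k' n
    unfolding A_def ui_def by (rule tracked.integral_on_strip(1)[OF tracked c1 vanish])
  have B_int: "integrable ?M (B z' n)" for z' n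
    using tracked.integral_on_strip(1)[OF tracked c1 vanish, of "\<lambda>s. cdist a (snd s) z'" n "\<lambda>_. 0"]
    by (simp add: B_def zi_def)
  have AB_nonneg: "0 \<le> integral\<^sup>L ?M (A (kn n) n) + integral\<^sup>L ?M (B (zn n) n)" for n
  proof -
    have "integral\<^sup>L ?M (A (kn n) n) + integral\<^sup>L ?M (B (zn n) n) =
        (LINT p|?M. A (kn n) n p + B (zn n) n p)"
      by (simp add: A_int B_int)
    then show ?thesis
      using tracked.entropy_tracked_nonneg[OF tracked c1 vanish kn zn kn_zn, of n]
      by (simp add: A_def B_def ui_def zi_def algebra_simps)
  qed

  define A' where "A' = (\<lambda>p. \<bar>uu p - k\<bar> * \<psi>t p + \<bar>uu p - k\<bar> * \<psi>x p)"
  define B' where "B' = (\<lambda>p. cdist a (zz p) zh * \<psi>t p)"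
  have A'_int: "integrable ?M A'"
  proof (rule Bochner_Integration.integrable_bound)
    \<comment> \<open>The constant \<open>k\<close> is not integrable over the strip. So the
      derivatives are bounded by \<open>2 * C\<close> only where they multiply \<open>uu\<close>,
      and the term with \<open>k\<close> keeps them as integrable factors.\<close>
    show "integrable ?M (\<lambda>p. 2 * C * \<bar>uu p\<bar> + \<bar>k\<bar> * (\<bar>\<psi>t p\<bar> + \<bar>\<psi>x p\<bar>))"
      using uu_int \<psi>_int by simp
    show "A' \<in> borel_measurable ?M"
      using borel_measurable_integrable[OF uu_int] unfolding A'_def by measurable
    show "AE p in ?M. norm (A' p) \<le> norm (2 * C * \<bar>uu p\<bar> + \<bar>k\<bar> * (\<bar>\<psi>t p\<bar> + \<bar>\<psi>x p\<bar>))"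
    proof (rule AE_I2)
      fix p
      have "norm (A' p) \<le> \<bar>uu p - k\<bar> * (\<bar>\<psi>t p\<bar> + \<bar>\<psi>x p\<bar>)"
        unfolding A'_def distrib_left[symmetric] by (simp add: abs_mult mult_left_mono abs_triangle_ineq)
      also have "\<dots> \<le> (\<bar>uu p\<bar> + \<bar>k\<bar>) * (\<bar>\<psi>t p\<bar> + \<bar>\<psi>x p\<bar>)"
        by (intro mult_right_mono) auto
      also have "\<dots> \<le> 2 * C * \<bar>uu p\<bar> + \<bar>k\<bar> * (\<bar>\<psi>t p\<bar> + \<bar>\<psi>x p\<bar>)"
        using mult_left_mono[of "\<bar>\<psi>t p\<bar> + \<bar>\<psi>x p\<bar>" "2 * C" "\<bar>uu p\<bar>"] C(2,3)[of p]
        by (simp add: algebra_simps)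
      finally show "norm (A' p) \<le> norm (2 * C * \<bar>uu p\<bar> + \<bar>k\<bar> * (\<bar>\<psi>t p\<bar> + \<bar>\<psi>x p\<bar>))"
        by simp
    qed
  qed
  have B'_int: "integrable ?M B'"
  proof (rule Bochner_Integration.integrable_bound)
    let ?K = "2 * measure lebesgue (preisach_triangle a)"
    show "integrable ?M (\<lambda>p. ?K * \<psi>t p)"
      using \<psi>_int by simp
    show "B' \<in> borel_measurable ?M"
      using zz_meas unfolding B'_def by measurable
    show "AE p in ?M. norm (B' p) \<le> norm (?K * \<psi>t p)"
      using zz
    proof eventually_elim
      case (elim p)
      have "\<bar>cdist a (zz p) zh\<bar> \<le> \<bar>?K\<bar>"
        using cdist_le[OF assms(1) elim zh] by (simp add: cdist_nonneg)
      then have "\<bar>cdist a (zz p) zh\<bar> * \<bar>\<psi>t p\<bar> \<le> \<bar>?K\<bar> * \<bar>\<psi>t p\<bar>"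
        by (rule mult_right_mono) simp
      then show ?case by (simp only: B'_def real_norm_def abs_mult)
    qed
  qed
  have A_lim: "(\<lambda>i. integral\<^sup>L ?M (A k (r i))) \<longlonglongrightarrow> integral\<^sup>L ?M A'"
  proof (rule integral_tendsto_of_bound[OF A_int A'_int _ _ ui_lim])
    \<comment> \<open>The modulus of the distance to \<open>k\<close> is 1-Lipschitz in
      \<open>u\<close>, and \<open>2 * C\<close> bounds the sum of the two derivatives.\<close>
    show "0 < 2 * C" using C(1) by simp
    show "AE p in ?M. \<bar>A k (r i) p - A' p\<bar> \<le> 2 * C * \<bar>ui (r i) p - uu p\<bar>" for i
    proof (rule AE_I2)
      fix p
      have "A k (r i) p - A' p = (\<bar>ui (r i) p - k\<bar> - \<bar>uu p - k\<bar>) * (\<psi>t p + \<psi>x p)"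
        by (simp add: A_def A'_def algebra_simps)
      then have "\<bar>A k (r i) p - A' p\<bar> = \<bar>\<bar>ui (r i) p - k\<bar> - \<bar>uu p - k\<bar>\<bar> * \<bar>\<psi>t p + \<psi>x p\<bar>"
        by (simp add: abs_mult)
      also have "\<dots> \<le> \<bar>ui (r i) p - uu p\<bar> * (2 * C)"
        using C(2,3)[of p] by (intro mult_mono) auto
      finally show "\<bar>A k (r i) p - A' p\<bar> \<le> 2 * C * \<bar>ui (r i) p - uu p\<bar>"
        by (simp add: mult.commute)
    qed
  qed
  have B_lim: "(\<lambda>i. integral\<^sup>L ?M (B zh (r i))) \<longlonglongrightarrow> integral\<^sup>L ?M B'"
  proof (rule integral_tendsto_of_bound[OF B_int B'_int C(1) _ zi_lim])
    show "AE p in ?M. \<bar>B zh (r i) p - B' p\<bar> \<le> C * cdist a (zi (r i) p) (zz p)" for i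
      using zz AE_space[of ?M]
    proof eventually_elim
      case (elim p)
      have z1: "zi (r i) p \<in> configs a" using zi elim(2) by simp
      have "\<bar>cdist a (zi (r i) p) zh - cdist a (zz p) zh\<bar> \<le> cdist a (zi (r i) p) (zz p)"
        using cdist_triangle[OF assms(1) z1 elim(1) zh] cdist_triangle[OF assms(1) elim(1) z1 zh]
          cdist_commute[of a "zz p" "zi (r i) p"] by linarith
      then have "\<bar>cdist a (zi (r i) p) zh - cdist a (zz p) zh\<bar> * \<bar>\<psi>t p\<bar> \<le> cdist a (zi (r i) p) (zz p) * C"
        using C(3)[of p] by (intro mult_mono) auto
      then show ?case
        by (simp add: B_def B'_def mult.commute flip: abs_mult right_diff_distrib)
    qed
  qed

  let ?e = "\<lambda>n. \<bar>kn n - k\<bar> + cdist a (zn n) zh"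
  let ?I = "LINT p|?M. \<bar>\<psi>t p\<bar> + \<bar>\<psi>x p\<bar>"
  \<comment> \<open>The cost of replacing \<open>k\<close>, \<open>zh\<close> by their grid
    approximations. Both distances change by at most \<open>?e n\<close>, uniformly in the
    approximate state, so the bound needs only the integral of the derivatives and
    \<open>?e n \<longlonglongrightarrow> 0\<close>.\<close>
  have lower: "- (?e n * ?I) \<le> integral\<^sup>L ?M (A k n) + integral\<^sup>L ?M (B zh n)" for n
  proof -
    have "(LINT p|?M. - ?e n * (\<bar>\<psi>t p\<bar> + \<bar>\<psi>x p\<bar>)) \<le>
        (LINT p|?M. (A k n p + B zh n p) - (A (kn n) n p + B (zn n) n p))"
    proof (rule integral_mono_AE)
      show "integrable ?M (\<lambda>p. - ?e n * (\<bar>\<psi>t p\<bar> + \<bar>\<psi>x p\<bar>))"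
        using \<psi>_int by simp
      show "integrable ?M (\<lambda>p. (A k n p + B zh n p) - (A (kn n) n p + B (zn n) n p))"
        by (intro Bochner_Integration.integrable_add Bochner_Integration.integrable_diff A_int B_int)
      show "AE p in ?M. - ?e n * (\<bar>\<psi>t p\<bar> + \<bar>\<psi>x p\<bar>) \<le>
          (A k n p + B zh n p) - (A (kn n) n p + B (zn n) n p)"
      proof (rule AE_I2)
        fix p assume "p \<in> space ?M"
        then have z1: "zi n p \<in> configs a" using zi by simp
        define d where "d = \<bar>ui n p - k\<bar> - \<bar>ui n p - kn n\<bar>"
        define d' where "d' = cdist a (zi n p) zh - cdist a (zi n p) (zn n)"
        have d: "\<bar>d\<bar> \<le> \<bar>kn n - k\<bar>" by (simp add: d_def)
        have d': "\<bar>d'\<bar> \<le> cdist a (zn n) zh"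
          using cdist_triangle[OF assms(1) z1 zn zh, of n] cdist_triangle[OF assms(1) z1 zh zn, of n]
            cdist_commute[of a zh "zn n"] unfolding d'_def by linarith
        have "- ((d + d') * \<psi>t p + d * \<psi>x p) \<le> \<bar>d + d'\<bar> * \<bar>\<psi>t p\<bar> + \<bar>d\<bar> * \<bar>\<psi>x p\<bar>"
          unfolding abs_mult[symmetric] by linarith
        also have "\<dots> \<le> ?e n * \<bar>\<psi>t p\<bar> + ?e n * \<bar>\<psi>x p\<bar>"
          using d d' by (intro add_mono mult_right_mono) auto
        finally have "- ?e n * (\<bar>\<psi>t p\<bar> + \<bar>\<psi>x p\<bar>) \<le> (d + d') * \<psi>t p + d * \<psi>x p"
          by (simp add: algebra_simps)
        also have "\<dots> = (A k n p + B zh n p) - (A (kn n) n p + B (zn n) n p)"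
          by (simp add: A_def B_def d_def d'_def algebra_simps)
        finally show "- ?e n * (\<bar>\<psi>t p\<bar> + \<bar>\<psi>x p\<bar>) \<le>
          (A k n p + B zh n p) - (A (kn n) n p + B (zn n) n p)" .
      qed
    qed
    moreover have "(LINT p|?M. - ?e n * (\<bar>\<psi>t p\<bar> + \<bar>\<psi>x p\<bar>)) = - (?e n * ?I)"
      by (subst integral_mult_right_zero) (simp add: left_diff_distrib distrib_right)
    moreover have "(LINT p|?M. (A k n p + B zh n p) - (A (kn n) n p + B (zn n) n p)) =
        integral\<^sup>L ?M (A k n) + integral\<^sup>L ?M (B zh n) -
        (integral\<^sup>L ?M (A (kn n) n) + integral\<^sup>L ?M (B (zn n) n))"
      using A_int B_int by simp
    ultimately show ?thesis using AB_nonneg[of n] by linarith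
  qed
  have "?e \<longlonglongrightarrow> \<bar>k - k\<bar> + 0"
    by (intro tendsto_intros kn_lim zn_lim)
  from tendsto_minus[OF tendsto_mult[OF LIMSEQ_subseq_LIMSEQ[OF this r] tendsto_const[of ?I]]]
  have "(\<lambda>i. - (?e (r i) * ?I)) \<longlonglongrightarrow> - ((\<bar>k - k\<bar> + 0) * ?I)"
    by (simp only: comp_def)
  moreover have "(\<lambda>i. integral\<^sup>L ?M (A k (r i)) + integral\<^sup>L ?M (B zh (r i))) \<longlonglongrightarrow>
      integral\<^sup>L ?M A' + integral\<^sup>L ?M B'"
    by (intro tendsto_intros A_lim B_lim)
  ultimately have "- ((\<bar>k - k\<bar> + 0) * ?I) \<le> integral\<^sup>L ?M A' + integral\<^sup>L ?M B'"
    by (rule LIMSEQ_le) (use lower in blast)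
  then have nonneg': "0 \<le> (LINT p|?M. A' p + B' p)"
    using A'_int B'_int by simp

  \<comment> \<open>On the strip times are positive, so the derivatives of \<open>\<phi>\<close> are
    those of its extension; elsewhere the indicator vanishes.\<close>
  have eq: "indicator (strip T) p *\<^sub>R entropy_integrand a u z k zh \<phi> p =
      indicator (strip T) p *\<^sub>R (A' p + B' p)" for p
  proof (cases p)
    case (Pair x t)
    then show ?thesis
      by (auto simp: indicator_def strip_def entropy_integrand_def A'_def B'_def uu_def zz_def
          deriv cdist_def algebra_simps)
  qed
  have "integrable ?M (\<lambda>p. A' p + B' p)"
    using A'_int B'_int by simp
  then have "set_integrable lebesgue (strip T) (entropy_integrand a u z k zh \<phi>)"
    unfolding set_integrable_def eq by (simp add: integrable_restrict_space)
  moreover have "0 \<le> (LINT p:strip T|lebesgue. entropy_integrand a u z k zh \<phi> p)"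
    using nonneg' unfolding set_lebesgue_integral_def eq by (simp add: integral_restrict_space)
  ultimately show "set_integrable lebesgue (strip T) (entropy_integrand a u z k zh \<phi>) \<and>
      0 \<le> (LINT p:strip T|lebesgue. entropy_integrand a u z k zh \<phi> p)" ..
qed

end
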